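(* In $\mathbb{R}^2$ let $m$ be the line $y=\frac12x-1$, $P=\left(-\frac{16}{5},-\frac{12}{5}\right)$, $Q=(-3,-3)$, and let $n$ be the line $y=-2$, $R=(0,0)$, $S=(1,-1)$. If $l_1,l_2$ are lines in $\mathbb{R}^2$ with $$P^{l_1}\in m,\qquad R^{l_2}\in n,\qquad Q^{l_1}=S^{l_2},$$ then the slope of $l_2$ is a root of the polynomial $$y^7+3y^6-3y^4+5y^3+y^2-10y-1,$$ whose Galois group over $\mathbb{Q}$ is isomorphic to $PSL_3(\mathbb{F}_2)$. Moreover there are exactly three points $G\in\mathbb{R}^2$ for which there exist lines $l_1,l_2$ in $\mathbb{R}^2$ with $P^{l_1}\in m$, $R^{l_2}\in n$ and $Q^{l_1}=G=S^{l_2}$.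
   Context: For a line $l\subset\mathbb{R}^2$ and a point $P\in\mathbb{R}^2$, $P^l$ denotes the image of $P$ under reflection across $l$. Finding $l_1,l_2$ from given $P,Q,R,S,m,n$ with the three conditions $P^{l_1}\in m$, $R^{l_2}\in n$, $Q^{l_1}=S^{l_2}$ is the 2-fold origami axiom AL6ab8 of Alperin and Lang. The Galois group of a polynomial over $\mathbb{Q}$ is the Galois group of its splitting field over $\mathbb{Q}$. *)

theory Defs
  imports
    "HOL-Analysis.Analysis"
    "HOL-Algebra.Algebraic_Closure_Type"
    "HOL-Algebra.Generated_Fields"
    "HOL-Algebra.Bij"
    "HOL-Algebra.Coset"
    "HOL-Library.Z2"
begin

definition is_line :: "(real^2) set \<Rightarrow> bool" where
  "is_line l \<longleftrightarrow> affine l \<and> aff_dim l = 1"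

(* On a line, closest_point is the foot of the perpendicular. *)
definition reflection :: "(real^2) set \<Rightarrow> real^2 \<Rightarrow> real^2" where
  "reflection l A = 2 *\<^sub>R closest_point l A - A"

(* Vertical lines have no slope. *)
definition has_slope :: "(real^2) set \<Rightarrow> real \<Rightarrow> bool" where
  "has_slope l s \<longleftrightarrow> (\<exists>c. l = {A. A $ 2 = s * A $ 1 + c})"

abbreviation complex_field :: "complex ring" where
  "complex_field \<equiv> ring_of_type_algebra"

(* The splitting field over the rationals, taken inside the complex numbers: a generated subfield
   contains 1 and hence all rationals, so nothing needs to be adjoined besides the roots. *)
definition splitting_field :: "rat poly \<Rightarrow> complex ring" where
  "splitting_field p = complex_field
     \<lparr>carrier := generate_field complex_field {z. poly (map_poly of_rat p) z = 0}\<rparr>"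

(* The automorphisms of L fixing F pointwise. As in BijGroup, maps are extensional on the carrier,
   so that each automorphism is represented by exactly one HOL function. *)
definition galois_group :: "('a, 'b) ring_scheme \<Rightarrow> 'a set \<Rightarrow> ('a \<Rightarrow> 'a) monoid" where
  "galois_group L F = BijGroup (carrier L)
     \<lparr>carrier := {\<sigma> \<in> Bij (carrier L). \<sigma> \<in> ring_iso L L \<and> (\<forall>x\<in>F. \<sigma> x = x)}\<rparr>"

definition galois_group_of_poly :: "rat poly \<Rightarrow> (complex \<Rightarrow> complex) monoid" where
  "galois_group_of_poly p = galois_group (splitting_field p) \<rat>"

definition group_center :: "('a, 'b) monoid_scheme \<Rightarrow> 'a set" where
  "group_center G =
     {z \<in> carrier G. \<forall>g \<in> carrier G. z \<otimes>\<^bsub>G\<^esub> g = g \<otimes>\<^bsub>G\<^esub> z}"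

definition SL :: "('a::field^'n^'n) monoid" where
  "SL = \<lparr>carrier = {A. det A = 1}, monoid.mult = (**), one = mat 1\<rparr>"

definition PSL :: "('a::field^'n^'n) set monoid" where
  "PSL = SL Mod (group_center SL)"

end

theory Submission
  imports Defs "HOL-Computational_Algebra.Fundamental_Theorem_Algebra"
begin

text \<open>A line that reflects the origin into \<open>y = -2\<close> is \<open>y = s x - (s\<^sup>2 + 1)\<close> for a unique
slope \<open>s\<close>, so the common image \<open>G\<close> of the two reflections is a rational function of \<open>s\<close>. It never
equals \<open>Q\<close>, hence the first line has to be the perpendicular bisector of \<open>Q\<close> and \<open>G\<close>. The condition on
\<open>P\<close> then becomes a cubic equation in the coordinates of \<open>G\<close>, and clearing denominators leaves
the septic in \<open>s\<close> (\<open>second_fold_iff\<close>). Different roots give different points \<open>G\<close>, and the septic has three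
real roots.

For the Galois group, a companion septic has the property that for each of its roots \<open>v\<close> the
given septic has a cubic factor with coefficients in \<open>\<int>[v]\<close> (\<open>septic_factorization\<close>). The seven
companion roots thus select seven triples among the seven roots. Locating all roots in small discs shows
that the triples are the lines of the Fano plane (\<open>incident_iff\<close>). An automorphism permutes the roots of both
polynomials and respects the cubic factors, so it acts on the roots as a collineation, that is as a
linear bijection of \<open>F\<^sub>2\<^sup>3\<close> (\<open>galois_action\<close>).

Conversely every such bijection occurs. The septic is irreducible: a factor of degree at most three would have integer
coefficients by Gauss's lemma, but no sum of at most three roots is an integer. Embeddings of
subfields of the complex numbers extend to algebraic elements, so the group is transitive on the roots
(\<open>galois_group_transitive\<close>). Complex conjugation fixes exactly three roots, which are collinear; it acts as a
transvection. A transitive group of collineations that contains a transvection contains all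
transvections and these generate the whole group (\<open>all_additive_bijections\<close>). Finally \<open>SL\<^sub>3(F\<^sub>2)\<close> has
trivial centre and over \<open>F\<^sub>2\<close> every invertible matrix has determinant one, so \<open>SL\<close>, \<open>PSL\<close> and \<open>GL\<close> agree.\<close>

section \<open>Roots near approximate zeros\<close>

text \<open>This bounds the logarithmic derivative \<open>\<Sum> 1/(a - z)\<close> by \<open>size A / \<delta>\<close>; it is stated
  without quotients, so that vanishing denominators need no attention.\<close>
lemma norm_pderiv_linear_factors:
  fixes A :: "complex multiset"
  assumes "\<forall>z\<in>#A. \<delta> < norm (a - z)" "\<delta> \<ge> 0"
  shows "\<delta> * norm (poly (pderiv (\<Prod>z\<in>#A. [:-z, 1:])) a) \<le> size A * norm (poly (\<Prod>z\<in>#A. [:-z, 1:]) a)"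
  using assms(1)
proof (induction A)
  case empty
  then show ?case by simp
next
  case (add z A)
  let ?g = "\<Prod>z\<in>#A. [:-z, 1:]"
  have IH: "\<delta> * norm (poly (pderiv ?g) a) \<le> size A * norm (poly ?g a)"
    using add by simp
  have az: "\<delta> \<le> norm (a - z)" using add.prems by (simp add: less_imp_le)
  have eq: "poly (pderiv ([:-z, 1:] * ?g)) a = poly ?g a + (a - z) * poly (pderiv ?g) a"
    unfolding pderiv_mult by (simp add: pderiv_pCons algebra_simps)
  have "\<delta> * norm (poly ?g a + (a - z) * poly (pderiv ?g) a)
        \<le> \<delta> * (norm (poly ?g a) + norm (a - z) * norm (poly (pderiv ?g) a))"
    using assms(2) by (intro mult_left_mono) (metis norm_mult norm_triangle_ineq, simp)
  also have "\<dots> = \<delta> * norm (poly ?g a) + norm (a - z) * (\<delta> * norm (poly (pderiv ?g) a))"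
    by (simp add: algebra_simps)
  also have "\<dots> \<le> norm (a - z) * norm (poly ?g a) + norm (a - z) * (size A * norm (poly ?g a))"
    by (intro add_mono mult_mono IH az) (use assms(2) in auto)
  also have "\<dots> = size (add_mset z A) * norm (poly ([:-z, 1:] * ?g) a)"
    unfolding poly_mult norm_mult by (simp add: algebra_simps)
  finally show ?case using eq by simp
qed

text \<open>If all roots were further than \<open>\<delta>\<close> from \<open>a\<close>, the bound on the logarithmic derivative would be
  violated. A single evaluation of \<open>f\<close> and its derivative thus locates a root.\<close>
lemma root_near:
  fixes f :: "complex poly"
  assumes "Polynomial.lead_coeff f = 1" "\<delta> \<ge> 0"
    and "Polynomial.degree f * norm (poly f a) < \<delta> * norm (poly (pderiv f) a)"
  shows "\<exists>z. poly f z = 0 \<and> norm (z - a) \<le> \<delta>"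
proof (rule ccontr)
  assume neg: "\<not> ?thesis"
  have "f \<noteq> 0" using assms(1) by auto
  from alg_closed_imp_factorization[OF this] assms(1)
  obtain A where A: "size A = Polynomial.degree f" "f = (\<Prod>z\<in>#A. [:-z, 1:])"
    by (metis smult_1_left)
  have "\<forall>z\<in>#A. \<delta> < norm (a - z)"
  proof
    fix z assume "z \<in># A"
    then have "poly f z = 0" unfolding A(2) poly_prod_mset by (auto simp: prod_mset_zero_iff)
    with neg show "\<delta> < norm (a - z)" by (metis norm_minus_commute not_le)
  qed
  from norm_pderiv_linear_factors[OF this assms(2)] A assms(3) show False by simp
qed

section \<open>The septic and its companion\<close>

text \<open>Polymorphic, because it is needed over \<open>\<int>\<close>, \<open>\<rat>\<close>, \<open>\<real>\<close> and \<open>\<complex>\<close>.\<close>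
definition septic :: "'a::comm_ring_1 poly" where
  "septic = [:-1, -10, 1, 5, -3, 0, 3, 1:]"

text \<open>The companion polynomial. If \<open>e\<^sub>1\<close> and \<open>e\<^sub>3\<close> are the sum and the product of the three roots of the septic
  on a line of the Fano plane, then \<open>v = 1 + (e\<^sub>1 - e\<^sub>3)/2\<close> is a root of it. This choice of
  \<open>v\<close> makes \<open>e\<^sub>1 = v\<^sup>2 + 2 v - 2\<close> and \<open>e\<^sub>3 = v\<^sup>2\<close>.\<close>
definition dual_septic :: "'a::comm_ring_1 poly" where
  "dual_septic = [:1, -5, 8, 0, -9, -1, 3, 1:]"

text \<open>Homogenised evaluation: the result is \<open>10000 ^ length cs\<close> times the value at \<open>(x + y \<i>) / 10000\<close>,
  so that only integers occur.\<close>
fun horner :: "int list \<Rightarrow> int \<Rightarrow> int \<Rightarrow> int \<times> int" where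
  "horner [] x y = (0, 0)"
| "horner (c # cs) x y =
    (let (u, v) = horner cs x y in (c * 10000 ^ Suc (length cs) + (x * u - y * v), x * v + y * u))"

definition decimal :: "int \<Rightarrow> int \<Rightarrow> complex" where
  "decimal x y = Complex (of_int x / 10000) (of_int y / 10000)"

lemma poly_horner:
  "10000 ^ length cs * poly (Poly (map of_int cs)) (decimal x y)
   = (case horner cs x y of (u, v) \<Rightarrow> Complex (of_int u) (of_int v))"
proof (induction cs)
  case Nil
  then show ?case by (simp add: complex_eq_iff)
next
  case (Cons c cs)
  obtain u v where uv: "horner cs x y = (u, v)" by fastforce
  let ?N = "10000 :: complex" and ?w = "decimal x y" and ?f = "poly (Poly (map of_int cs)) (decimal x y)"
  have "?N ^ length (c # cs) * poly (Poly (map of_int (c # cs))) ?w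
      = of_int c * ?N ^ Suc (length cs) + (?N * ?w) * (?N ^ length cs * ?f)"
    by (simp add: algebra_simps)
  also have "?N ^ length cs * ?f = Complex (of_int u) (of_int v)" using Cons uv by simp
  also have "?N * ?w = Complex (of_int x) (of_int y)" by (simp add: decimal_def complex_eq_iff)
  also have "of_int c * ?N ^ Suc (length cs) = of_real (of_int (c * 10000 ^ Suc (length cs)))"
    by simp
  finally show ?case using uv by (simp add: Let_def complex_eq_iff del: power_Suc of_int_mult)
     (simp add: complex_eq_iff)
qed

text \<open>The norms in \<open>root_near\<close> are replaced by sums of absolute values of the
  coordinates; this costs the factor 2 in the hypothesis and leaves an integer inequality.\<close>
lemma root_near_decimal:
  fixes cs ds :: "int list"
  defines "f \<equiv> (Poly (map of_int cs) :: complex poly)"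
  assumes f: "Polynomial.lead_coeff f = 1" "pderiv f = Poly (map of_int ds)"
    and len: "length cs = Suc (length ds)" "Polynomial.degree f = length ds"
    and h: "horner cs x y = (u, v)" "horner ds x y = (u', v')"
    and lt: "2 * length ds * (\<bar>u\<bar> + \<bar>v\<bar>) < 10 * (\<bar>u'\<bar> + \<bar>v'\<bar>)"
  shows "\<exists>z. poly f z = 0 \<and> norm (z - decimal x y) \<le> 1/1000"
proof (rule root_near[OF f(1)])
  let ?N = "10000 ^ length ds :: real" and ?u = "Complex (of_int u) (of_int v)" and ?u' = "Complex (of_int u') (of_int v')"
  define P Q where "P = norm (poly f (decimal x y))" and "Q = norm (poly (pderiv f) (decimal x y))"
  have p: "10000 ^ length cs * poly f (decimal x y) = ?u"
      "10000 ^ length ds * poly (pderiv f) (decimal x y) = ?u'"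
    unfolding f(2) unfolding f_def by (simp_all only: poly_horner h prod.case)
  have n: "norm ?u = 10000 * ?N * P" "norm ?u' = ?N * Q"
    unfolding p[symmetric] P_def Q_def by (simp_all add: len norm_mult norm_power)
  have "norm ?u \<le> \<bar>of_int u\<bar> + \<bar>of_int v\<bar>" using cmod_le[of ?u] by simp
  then have "real (2 * length ds) * norm ?u \<le> real (2 * length ds) * (\<bar>real_of_int u\<bar> + \<bar>real_of_int v\<bar>)"
    by (rule mult_left_mono) simp
  also have "\<dots> = real_of_int (int (2 * length ds) * (\<bar>u\<bar> + \<bar>v\<bar>))" by simp
  also have "\<dots> < real_of_int (10 * (\<bar>u'\<bar> + \<bar>v'\<bar>))"
    using lt by (simp only: of_int_less_iff)
  also have "\<dots> = 10 * (\<bar>real_of_int u'\<bar> + \<bar>of_int v'\<bar>)" by simp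
  also have "\<bar>real_of_int u'\<bar> + \<bar>real_of_int v'\<bar> \<le> 2 * norm ?u'"
    using abs_Re_le_cmod[of ?u'] abs_Im_le_cmod[of ?u'] by simp
  finally have "?N * (real (2 * length ds) * (10000 * P)) < ?N * (10 * (2 * Q))"
    unfolding n by (simp only: mult_ac)
  then have "real (2 * length ds) * (10000 * P) < 10 * (2 * Q)"
    by (rule mult_left_less_imp_less) simp
  then show "Polynomial.degree f * norm (poly f (decimal x y)) < 1/1000 * norm (poly (pderiv f) (decimal x y))"
    unfolding P_def[symmetric] Q_def[symmetric] len(2) by linarith
qed simp

text \<open>Four decimals of the seven roots. The binary digits of an index \<open>1, \<dots>, 7\<close> form a nonzero vector of \<open>F\<^sub>2\<^sup>3\<close>,
  and the roots are numbered such that collinear triples have sum zero, that the three real roots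
  are \<open>1, 2, 3\<close>, and that complex conjugation becomes linear.\<close>
definition root_re :: "nat \<Rightarrow> int" where
  "root_re i = [0, 11324, -18950, -995, 6366, 6366, -17056, -17056] ! i"

definition root_im :: "nat \<Rightarrow> int" where
  "root_im i = [0, 0, 0, 0, -10701, 10701, -3330, 3330] ! i"

text \<open>Four decimals of the companion roots; the binary digits of an index are the coordinates of the linear
  form whose kernel is the corresponding line.\<close>
definition dual_re :: "nat \<Rightarrow> int" where
  "dual_re i = [0, -18484, 13250, 3795, 4622, -18484, -18493, 3795] ! i"

definition dual_im :: "nat \<Rightarrow> int" where
  "dual_im i = [0, 8269, 0, -2672, 0, -8269, 0, 2672] ! i"

lemma degree_septic [simp]: "Polynomial.degree (septic :: 'a::comm_ring_1 poly) = 7"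
  "Polynomial.degree (dual_septic :: 'a::comm_ring_1 poly) = 7"
  by (simp_all add: septic_def dual_septic_def)

lemma lead_septic [simp]: "Polynomial.coeff (septic :: 'a::comm_ring_1 poly) 7 = 1"
  "Polynomial.coeff (dual_septic :: 'a::comm_ring_1 poly) 7 = 1"
  by (simp_all add: septic_def dual_septic_def eval_nat_numeral)

lemma septic_root_near:
  assumes "i \<in> {1..<8}"
  shows "\<exists>z. poly septic z = 0 \<and> norm (z - decimal (root_re i) (root_im i)) \<le> 1/1000"
proof -
  define cs ds :: "int list" where "cs = [-1, -10, 1, 5, -3, 0, 3, 1]" and "ds = [-10, 2, 15, -12, 0, 18, 7]"
  have eq: "(septic :: complex poly) = Poly (map of_int cs)"
    by (simp add: septic_def cs_def)
  have eq': "pderiv (septic :: complex poly) = Poly (map of_int ds)"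
    by (simp add: septic_def pderiv_pCons ds_def)
  obtain u v where uv: "horner cs (root_re i) (root_im i) = (u, v)" by fastforce
  obtain u' v' where uv': "horner ds (root_re i) (root_im i) = (u', v')" by fastforce
  have "list_all (\<lambda>i. case horner cs (root_re i) (root_im i) of (u, v) \<Rightarrow>
     case horner ds (root_re i) (root_im i) of (u', v') \<Rightarrow>
       14 * (\<bar>u\<bar> + \<bar>v\<bar>) < 10 * (\<bar>u'\<bar> + \<bar>v'\<bar>)) [1..<8]"
    unfolding cs_def ds_def by code_simp
  with assms have "14 * (\<bar>u\<bar> + \<bar>v\<bar>) < 10 * (\<bar>u'\<bar> + \<bar>v'\<bar>)"
    unfolding list_all_iff set_upt using uv uv' by fastforce
  then have "2 * length ds * (\<bar>u\<bar> + \<bar>v\<bar>) < 10 * (\<bar>u'\<bar> + \<bar>v'\<bar>)"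
    by (simp add: ds_def)
  from root_near_decimal[OF _ _ _ _ uv uv' this, folded eq, OF _ eq'] show ?thesis
    by (simp add: cs_def ds_def)
qed

lemma dual_root_near:
  assumes "i \<in> {1..<8}"
  shows "\<exists>z. poly dual_septic z = 0 \<and> norm (z - decimal (dual_re i) (dual_im i)) \<le> 1/1000"
proof -
  define cs ds :: "int list" where "cs = [1, -5, 8, 0, -9, -1, 3, 1]" and "ds = [-5, 16, 0, -36, -5, 18, 7]"
  have eq: "(dual_septic :: complex poly) = Poly (map of_int cs)"
    by (simp add: dual_septic_def cs_def)
  have eq': "pderiv (dual_septic :: complex poly) = Poly (map of_int ds)"
    by (simp add: dual_septic_def pderiv_pCons ds_def)
  obtain u v where uv: "horner cs (dual_re i) (dual_im i) = (u, v)" by fastforce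
  obtain u' v' where uv': "horner ds (dual_re i) (dual_im i) = (u', v')" by fastforce
  have "list_all (\<lambda>i. case horner cs (dual_re i) (dual_im i) of (u, v) \<Rightarrow>
     case horner ds (dual_re i) (dual_im i) of (u', v') \<Rightarrow>
       14 * (\<bar>u\<bar> + \<bar>v\<bar>) < 10 * (\<bar>u'\<bar> + \<bar>v'\<bar>)) [1..<8]"
    unfolding cs_def ds_def by code_simp
  with assms have "14 * (\<bar>u\<bar> + \<bar>v\<bar>) < 10 * (\<bar>u'\<bar> + \<bar>v'\<bar>)"
    unfolding list_all_iff set_upt using uv uv' by fastforce
  then have "2 * length ds * (\<bar>u\<bar> + \<bar>v\<bar>) < 10 * (\<bar>u'\<bar> + \<bar>v'\<bar>)"
    by (simp add: ds_def)
  from root_near_decimal[OF _ _ _ _ uv uv' this, folded eq, OF _ eq'] show ?thesis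
    by (simp add: cs_def ds_def)
qed

section \<open>The roots of both septics\<close>

text \<open>Index 0 gets the value 0: field homomorphisms fix it, as linear maps fix the zero vector, so
  the labelling extends to all of \<open>F\<^sub>2\<^sup>3\<close>.\<close>
definition septic_root :: "nat \<Rightarrow> complex" where
  "septic_root i = (if i \<in> {1..<8} then
     SOME z. poly septic z = 0 \<and> norm (z - decimal (root_re i) (root_im i)) \<le> 1/1000 else 0)"

definition dual_root :: "nat \<Rightarrow> complex" where
  "dual_root i = (if i \<in> {1..<8} then
     SOME z. poly dual_septic z = 0 \<and> norm (z - decimal (dual_re i) (dual_im i)) \<le> 1/1000 else 0)"

text \<open>Errors are counted in units of \<open>10\<^sup>-\<^sup>4\<close> and separately in both coordinates, which makes them additive
  and comparable with integers.\<close>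
definition close :: "int \<Rightarrow> complex \<Rightarrow> int \<Rightarrow> int \<Rightarrow> bool" where
  "close n z x y \<longleftrightarrow> \<bar>10000 * Re z - of_int x\<bar> \<le> of_int n \<and> \<bar>10000 * Im z - of_int y\<bar> \<le> of_int n"

lemma close_if_near:
  assumes "norm (z - decimal x y) \<le> 1/1000"
  shows "close 10 z x y"
proof -
  have "\<bar>Re (z - decimal x y)\<bar> \<le> 1/1000" "\<bar>Im (z - decimal x y)\<bar> \<le> 1/1000"
    using abs_Re_le_cmod[of "z - decimal x y"] abs_Im_le_cmod[of "z - decimal x y"] assms by linarith+
  then show ?thesis by (auto simp: close_def decimal_def field_simps abs_le_iff)
qed

lemma close_add: "close n z x y \<Longrightarrow> close m w x' y' \<Longrightarrow> close (n + m) (z + w) (x + x') (y + y')"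
  by (auto simp: close_def algebra_simps abs_le_iff)

lemma close_unique:
  assumes "close n z x y" "close m z x' y'"
  shows "\<bar>x - x'\<bar> \<le> n + m \<and> \<bar>y - y'\<bar> \<le> n + m"
proof -
  have "real_of_int x - x' \<le> n + m" "real_of_int x' - x \<le> n + m"
       "real_of_int y - y' \<le> n + m" "real_of_int y' - y \<le> n + m"
    using assms unfolding close_def by linarith+
  then show ?thesis by linarith
qed

lemma close_cnj: "close n z x y \<Longrightarrow> close n (cnj z) x (- y)"
  by (auto simp: close_def abs_le_iff)

lemma septic_root:
  assumes "i \<in> {1..<8}"
  shows poly_septic_root: "poly septic (septic_root i) = 0"
    and "close 10 (septic_root i) (root_re i) (root_im i)"
  using someI_ex[OF septic_root_near[OF assms]] assms
  unfolding septic_root_def by (auto intro: close_if_near)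

lemma dual_root:
  assumes "i \<in> {1..<8}"
  shows poly_dual_root: "poly dual_septic (dual_root i) = 0"
    and close_dual_root: "close 10 (dual_root i) (dual_re i) (dual_im i)"
  using someI_ex[OF dual_root_near[OF assms]] assms
  unfolding dual_root_def by (auto intro: close_if_near)

lemma septic_root_0 [simp]: "septic_root 0 = 0" and dual_root_0 [simp]: "dual_root 0 = 0"
  by (simp_all add: septic_root_def dual_root_def)

lemma close_septic_root:
  assumes "i < 8"
  shows "close 10 (septic_root i) (root_re i) (root_im i)"
proof (cases "i = 0")
  case True
  then show ?thesis by (simp add: close_def root_re_def root_im_def)
next
  case False
  with assms septic_root show ?thesis by simp
qed

lemma all_less_8: "list_all P [0..<8] \<Longrightarrow> i < 8 \<Longrightarrow> P i"
  by (simp add: list_all_iff)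

lemma root_separation:
  assumes "i < 8" "j < 8" "\<bar>root_re i - root_re j\<bar> \<le> 20" "\<bar>root_im i - root_im j\<bar> \<le> 20"
  shows "i = j"
proof -
  have "list_all (\<lambda>i. list_all (\<lambda>j. \<bar>root_re i - root_re j\<bar> \<le> 20 \<and> \<bar>root_im i - root_im j\<bar> \<le> 20 \<longrightarrow> i = j)
    [0..<8]) [0..<8]" by code_simp
  from all_less_8[OF all_less_8[OF this assms(1)] assms(2)] assms(3,4) show ?thesis by simp
qed

lemma dual_separation:
  assumes "i < 8" "j < 8" "\<bar>dual_re i - dual_re j\<bar> \<le> 20" "\<bar>dual_im i - dual_im j\<bar> \<le> 20"
  shows "i = j"
proof -
  have "list_all (\<lambda>i. list_all (\<lambda>j. \<bar>dual_re i - dual_re j\<bar> \<le> 20 \<and> \<bar>dual_im i - dual_im j\<bar> \<le> 20 \<longrightarrow> i = j)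
    [0..<8]) [0..<8]" by code_simp
  from all_less_8[OF all_less_8[OF this assms(1)] assms(2)] assms(3,4) show ?thesis by simp
qed

lemma inj_septic_root: "inj_on septic_root {..<8}"
proof (rule inj_onI)
  fix i j :: nat
  assume "i \<in> {..<8}" "j \<in> {..<8}" "septic_root i = septic_root j"
  then show "i = j"
    using close_unique[of 10 _ "root_re i" "root_im i" 10] close_septic_root[of i] close_septic_root[of j]
      root_separation[of i j] by force
qed

lemma inj_dual_root: "inj_on dual_root {1..<8}"
proof (rule inj_onI)
  fix i j :: nat
  assume "i \<in> {1..<8}" "j \<in> {1..<8}" "dual_root i = dual_root j"
  then show "i = j"
    using close_unique[of 10 _ "dual_re i" "dual_im i" 10] close_dual_root[of i] close_dual_root[of j]
      dual_separation[of i j] by force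
qed

lemma zeros_image:
  fixes f :: "complex poly"
  assumes "Polynomial.degree f = 7" "inj_on g {1..<8::nat}" "\<And>i. i \<in> {1..<8} \<Longrightarrow> poly f (g i) = 0"
  shows "{z. poly f z = 0} = g ` {1..<8}"
proof (rule sym, rule card_subset_eq)
  have "f \<noteq> 0" using assms(1) by auto
  then show "finite {z. poly f z = 0}" by (rule poly_roots_finite)
  show "g ` {1..<8} \<subseteq> {z. poly f z = 0}" using assms(3) by auto
  have "card (g ` {1..<8}) = 7" using card_image[OF assms(2)] by simp
  moreover from this have "7 \<le> card {z. poly f z = 0}"
    using card_mono[OF \<open>finite {z. poly f z = 0}\<close> \<open>g ` {1..<8} \<subseteq> _\<close>] by simp
  moreover have "card {z. poly f z = 0} \<le> 7"
    using card_poly_roots_bound[OF \<open>f \<noteq> 0\<close>] assms(1) by simp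
  ultimately show "card (g ` {1..<8}) = card {z. poly f z = 0}" by simp
qed

lemma septic_zeros: "{z. poly septic z = 0} = septic_root ` {1..<8}"
  by (rule zeros_image) (auto intro: inj_on_subset[OF inj_septic_root] poly_septic_root)

lemma dual_septic_zeros: "{z. poly dual_septic z = 0} = dual_root ` {1..<8}"
  by (rule zeros_image) (use inj_dual_root poly_dual_root in auto)

definition conj_index :: "nat \<Rightarrow> nat" where
  "conj_index i = [0, 1, 2, 3, 5, 4, 7, 6] ! i"

text \<open>The conjugate is again a root and lies in the mirrored disc, which meets only one of the seven discs.\<close>
lemma cnj_septic_root:
  assumes "i < 8"
  shows "cnj (septic_root i) = septic_root (conj_index i)"
proof (cases "i = 0")
  case True
  then show ?thesis by (simp add: conj_index_def)
next
  case False
  then have i: "i \<in> {1..<8}" using assms by simp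
  have sep: "poly (septic :: complex poly) (cnj z) = cnj (poly septic z)" for z :: complex
    by (simp add: septic_def)
  have "cnj (septic_root i) \<in> {z. poly septic z = 0}"
    using poly_septic_root[OF i] by (simp add: sep)
  then obtain j where j: "j \<in> {1..<8}" "cnj (septic_root i) = septic_root j"
    unfolding septic_zeros by auto
  have *: "list_all (\<lambda>i. conj_index i < 8 \<and> root_re (conj_index i) = root_re i
       \<and> root_im (conj_index i) = - root_im i) [0..<8]"
    by code_simp
  have "close 10 (septic_root j) (root_re i) (- root_im i)"
    using close_cnj[OF close_septic_root[OF assms]] j by simp
  from close_unique[OF this close_septic_root[of j]] j(1) all_less_8[OF * assms]
  have "conj_index i = j" by (intro root_separation) auto
  then show ?thesis using j by simp
qed

text \<open>Since index 0 stands for the number 0, this also covers single roots and sums of two roots. The second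
  highest coefficient of a hypothetical factor of degree at most three is such a sum, up to sign.\<close>
lemma sum_roots_not_Ints:
  assumes "i < 8" "j < 8" "l < 8" "i + j + l > 0"
  shows "septic_root i + septic_root j + septic_root l \<notin> \<int>"
proof
  assume "septic_root i + septic_root j + septic_root l \<in> \<int>"
  then obtain n where n: "septic_root i + septic_root j + septic_root l = of_int n" by (auto elim: Ints_cases)
  \<comment> \<open>30 is the total error of three roots, in units of the fourth decimal.\<close>
  have "list_all (\<lambda>i. list_all (\<lambda>j. list_all (\<lambda>l. i + j + l > 0 \<longrightarrow>
     \<bar>root_im i + root_im j + root_im l\<bar> > 30 \<or> (30 < (root_re i + root_re j + root_re l) mod 10000
      \<and> (root_re i + root_re j + root_re l) mod 10000 < 9970)) [0..<8]) [0..<8]) [0..<8]" by code_simp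
  from all_less_8[OF all_less_8[OF all_less_8[OF this assms(1)] assms(2)] assms(3)] assms(4)
  have chk: "\<bar>root_im i + root_im j + root_im l\<bar> > 30 \<or> (30 < (root_re i + root_re j + root_re l) mod 10000
      \<and> (root_re i + root_re j + root_re l) mod 10000 < 9970)" by blast
  have "close 0 (of_int n) (10000 * n) 0" by (simp add: close_def)
  from close_unique[OF close_add[OF close_add[OF close_septic_root[OF assms(1)] close_septic_root[OF assms(2)]]
      close_septic_root[OF assms(3)], unfolded n] this]
  have "\<bar>root_re i + root_re j + root_re l - 10000 * n\<bar> \<le> 30" "\<bar>root_im i + root_im j + root_im l\<bar> \<le> 30" by simp_all
  moreover have "s mod 10000 \<le> 30 \<or> 9970 \<le> s mod 10000" if "\<bar>s - 10000 * n\<bar> \<le> 30" for s :: int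
  proof (cases "s < 10000 * n")
    note dm = div_mult_mod_eq[of s 10000] pos_mod_bound[of 10000 s] pos_mod_sign[of 10000 s]
    case True
    then have "s div 10000 < n" using dm by linarith
    then show ?thesis using that dm by linarith
  next
    note dm = div_mult_mod_eq[of s 10000] pos_mod_bound[of 10000 s] pos_mod_sign[of 10000 s]
    case False
    then have "n \<le> s div 10000" using dm by linarith
    then show ?thesis using that dm by linarith
  qed
  ultimately show False using chk by fastforce
qed

section \<open>Triples of roots\<close>

text \<open>The factor whose roots are the three roots on the line with parameter \<open>v\<close>. The coefficients are
  written as values of integer polynomials at \<open>v\<close>, the form in which automorphisms act on them.\<close>
definition cubic :: "'a::comm_ring_1 \<Rightarrow> 'a poly" where
  "cubic v = [: poly [:0, 0, -1:] v, poly [:0, 0, -8, -6, 3, 4, 1:] v,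
     poly [:2, -2, -1:] v, 1 :]"

definition quartic :: "'a::comm_ring_1 \<Rightarrow> 'a poly" where
  "quartic v = [: poly [:17, -40, 9, 46, 2, -16, -5:] v, poly [:7, -28, 19, 38, -2, -14, -4:] v,
     poly [:-2, -2, 11, 10, -2, -4, -1:] v, poly [:1, 2, 1:] v, 1 :]"

text \<open>The coefficients of \<open>cubic v * quartic v\<close> agree with those of the septic only modulo the companion
  polynomial. Each comparison is a polynomial identity in \<open>v\<close> with an explicit multiple
  of \<open>dual_septic\<close>, found by division with remainder.\<close>
lemma septic_factorization:
  fixes v :: "'a::comm_ring_1"
  assumes "poly dual_septic v = 0"
  shows "septic = cubic v * quartic v"
proof -
  have "[:0, 0, -1:] * [:17, -40, 9, 46, 2, -16, -5:] + dual_septic * [:-1, -5:] = ([:-1:] :: 'a poly)"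
       "[:0, 0, -1:] * [:7, -28, 19, 38, -2, -14, -4:] + [:0, 0, -8, -6, 3, 4, 1:] * [:17, -40, 9, 46, 2, -16, -5:] + dual_septic * [:-10, -50, -27, 19, 21, 5:] = ([:-10:] :: 'a poly)"
       "[:0, 0, -1:] * [:-2, -2, 11, 10, -2, -4, -1:] + [:0, 0, -8, -6, 3, 4, 1:] * [:7, -28, 19, 38, -2, -14, -4:] + [:2, -2, -1:] * [:17, -40, 9, 46, 2, -16, -5:] + dual_septic * [:-33, -51, -18, 20, 18, 4:] = ([:1:] :: 'a poly)"
       "[:0, 0, -1:] * [:1, 2, 1:] + [:0, 0, -8, -6, 3, 4, 1:] * [:-2, -2, 11, 10, -2, -4, -1:] + [:2, -2, -1:] * [:7, -28, 19, 38, -2, -14, -4:] + [:17, -40, 9, 46, 2, -16, -5:] + dual_septic * [:-26, -20, -3, 7, 5, 1:] = ([:5:] :: 'a poly)"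
       "[:0, 0, -1:] + [:0, 0, -8, -6, 3, 4, 1:] * [:1, 2, 1:] + [:2, -2, -1:] * [:-2, -2, 11, 10, -2, -4, -1:] + [:7, -28, 19, 38, -2, -14, -4:] + dual_septic * [:-6, -2:] = ([:-3:] :: 'a poly)"
       "[:0, 0, -8, -6, 3, 4, 1:] + [:2, -2, -1:] * [:1, 2, 1:] + [:-2, -2, 11, 10, -2, -4, -1:] = ([:0:] :: 'a poly)"
       "[:2, -2, -1:] + [:1, 2, 1:] = ([:3:] :: 'a poly)"
    by (simp_all add: dual_septic_def)
  note eqs = this[THEN arg_cong[of _ _ "\<lambda>f. poly f v"], unfolded poly_add poly_mult assms mult_zero_left add_0_right]
  have "poly [:c:] v = c" for c by simp
  from eqs[unfolded this] show ?thesis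
    unfolding septic_def cubic_def quartic_def by (simp add: algebra_simps del: poly_pCons)
qed

text \<open>Incidence of a line and a point of the Fano plane: the digits of \<open>k\<close> are read as a linear form and those of \<open>i\<close> as
  a vector over \<open>F\<^sub>2\<close>.\<close>
definition incident :: "nat \<Rightarrow> nat \<Rightarrow> bool" where
  "incident k i \<longleftrightarrow> even ((k mod 2) * (i mod 2) + (k div 2 mod 2) * (i div 2 mod 2) + (k div 4) * (i div 4))"

text \<open>The map \<open>v \<mapsto> v\<^sup>2 + 2 v - 2\<close> magnifies an error by about \<open>\<bar>2 v + 2\<bar>\<close>, which is below 10 in the relevant range.
  Everything is scaled by \<open>10\<^sup>8\<close>.\<close>
lemma close_quadratic:
  assumes v: "close 10 v x y" and bound: "\<bar>x\<bar> \<le> 20000" "\<bar>y\<bar> \<le> 20000"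
    and w: "close 30 (v^2 + 2 * v - 2) s t"
  shows "\<bar>10000 * s - (x^2 - y^2 + 20000 * x - 200000000)\<bar> \<le> 2000000
       \<and> \<bar>10000 * t - (2 * x * y + 20000 * y)\<bar> \<le> 2000000"
proof -
  define h k where "h = 10000 * Re v - x" and "k = 10000 * Im v - y"
  have hk: "\<bar>h\<bar> \<le> 10" "\<bar>k\<bar> \<le> 10" using v by (auto simp: close_def h_def k_def)
  have x: "\<bar>real_of_int x\<bar> \<le> 20000" and y: "\<bar>real_of_int y\<bar> \<le> 20000"
    using bound by linarith+
  have b: "\<bar>h * x\<bar> \<le> 10 * 20000" "\<bar>k * y\<bar> \<le> 10 * 20000" "\<bar>h * y\<bar> \<le> 10 * 20000" "\<bar>k * x\<bar> \<le> 10 * 20000"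
     "\<bar>h * h\<bar> \<le> 10 * 10" "\<bar>k * k\<bar> \<le> 10 * 10" "\<bar>h * k\<bar> \<le> 10 * 10"
    unfolding abs_mult by (intro mult_mono hk x y; simp)+
  have v_eq: "Re v = (x + h) / 10000" "Im v = (y + k) / 10000" by (simp_all add: h_def k_def)
  have re: "100000000 * Re (v^2 + 2 * v - 2) = x^2 - y^2 + 20000 * x - 200000000
      + (2 * (h * x) - 2 * (k * y) + h * h - k * k + 20000 * h)"
    and im: "100000000 * Im (v^2 + 2 * v - 2) = 2 * x * y + 20000 * y
      + (2 * (h * y) + 2 * (k * x) + 2 * (h * k) + 20000 * k)"
    by (simp_all add: power2_eq_square v_eq field_simps)
  have "\<bar>10000 * Re (v^2 + 2 * v - 2) - s\<bar> \<le> 30" "\<bar>10000 * Im (v^2 + 2 * v - 2) - t\<bar> \<le> 30"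
    using w by (simp_all only: close_def of_int_numeral)
  then have "\<bar>10000 * s - (x^2 - y^2 + 20000 * x - 200000000)\<bar> \<le> real_of_int 2000000"
     "\<bar>10000 * t - (2 * x * y + 20000 * y)\<bar> \<le> real_of_int 2000000"
    using re im b hk unfolding abs_le_iff of_int_numeral by linarith+
  then have "real_of_int \<bar>10000 * s - (x^2 - y^2 + 20000 * x - 200000000)\<bar> \<le> real_of_int 2000000"
     "real_of_int \<bar>10000 * t - (2 * x * y + 20000 * y)\<bar> \<le> real_of_int 2000000"
    by simp_all
  then show ?thesis unfolding of_int_le_iff by blast
qed

text \<open>Four decimals of \<open>v\<^sup>2 + 2 v - 2\<close> for the seven companion roots \<open>v\<close>, the sum of the three roots
  on the line.\<close>
definition line_sum_re :: "nat \<Rightarrow> int" where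
  "line_sum_re k = [0, -29639, 24057, -11685, -8621, -29639, -22788, -11685] ! k"

definition line_sum_im :: "nat \<Rightarrow> int" where
  "line_sum_im k = [0, -14031, 0, -7371, 0, 14031, 0, 7371] ! k"

definition with_value :: "(nat \<Rightarrow> int) \<Rightarrow> (nat \<Rightarrow> int) \<Rightarrow> (nat \<times> int \<times> int) list" where
  "with_value f g = map (\<lambda>i. (i, f i, g i)) [1..<8]"

lemma line_sum_approx:
  assumes "k < 8"
  shows "\<bar>10000 * line_sum_re k - ((dual_re k)^2 - (dual_im k)^2 + 20000 * dual_re k - 200000000)\<bar> \<le> 500000
     \<and> \<bar>10000 * line_sum_im k - (2 * dual_re k * dual_im k + 20000 * dual_im k)\<bar> \<le> 500000
     \<or> k = 0"
proof -
  have "list_all (\<lambda>k. \<bar>10000 * line_sum_re k - ((dual_re k)^2 - (dual_im k)^2 + 20000 * dual_re k - 200000000)\<bar> \<le> 500000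
     \<and> \<bar>10000 * line_sum_im k - (2 * dual_re k * dual_im k + 20000 * dual_im k)\<bar> \<le> 500000 \<or> k = 0) [0..<8]"
    by code_simp
  from all_less_8[OF this assms] show ?thesis .
qed

text \<open>The tables are arguments, so that they are computed once and not in each round of the nested loops; the
  conditionals delay the last test to the few triples that reach it.\<close>
definition triples_ok :: "(nat \<times> int \<times> int) list \<Rightarrow> (nat \<times> int \<times> int) list \<Rightarrow> bool" where
  "triples_ok ss rs \<longleftrightarrow> (\<forall>(k, s, t)\<in>set ss. \<forall>(i, a, a')\<in>set rs. \<forall>(j, b, b')\<in>set rs. \<forall>(l, c, c')\<in>set rs.
     if \<bar>a + b + c - s\<bar> \<le> 300 then if \<bar>a' + b' + c' - t\<bar> \<le> 300 then
       \<forall>m\<in>set [1..<8]. incident k m \<longleftrightarrow> m = i \<or> m = j \<or> m = l else True else True)"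

text \<open>No other sum of three roots, repetitions included, comes within 0.03 of the sum of the three roots on a
  line.\<close>
lemma line_sum_unique:
  assumes "k \<in> {1..<8}" "i \<in> {1..<8}" "j \<in> {1..<8}" "l \<in> {1..<8}" "m \<in> {1..<8}"
    and "\<bar>root_re i + root_re j + root_re l - line_sum_re k\<bar> \<le> 300"
    and "\<bar>root_im i + root_im j + root_im l - line_sum_im k\<bar> \<le> 300"
  shows "incident k m \<longleftrightarrow> m = i \<or> m = j \<or> m = l"
proof -
  have mem: "(n, f n, g n) \<in> set (with_value f g)" if "n \<in> {1..<8}" for n f g
    unfolding with_value_def using that by simp
  have "triples_ok (with_value line_sum_re line_sum_im) (with_value root_re root_im)"
    by code_simp
  note chk = this[unfolded triples_ok_def]
  from bspec[OF chk mem[OF assms(1)], unfolded prod.case, THEN bspec, OF mem[OF assms(2)], unfolded prod.case,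
      THEN bspec, OF mem[OF assms(3)], unfolded prod.case, THEN bspec, OF mem[OF assms(4)], unfolded prod.case]
  show ?thesis using assms(5-7) by auto
qed

text \<open>Complex polynomials split, and all roots of the septic are numbered.\<close>
lemma septic_divisor_split:
  fixes f :: "complex poly"
  assumes monic: "Polynomial.lead_coeff f = 1" and zeros: "\<And>z. poly f z = 0 \<Longrightarrow> poly septic z = 0"
  obtains ns where "set ns \<subseteq> {1..<8}" "length ns = Polynomial.degree f"
    "f = (\<Prod>i\<leftarrow>ns. [:-septic_root i, 1:])"
proof -
  from monic have "f \<noteq> 0" by auto
  from alg_closed_imp_factorization[OF this] monic
  obtain A where A: "size A = Polynomial.degree f" "f = (\<Prod>z\<in>#A. [:-z, 1:])" by auto
  have A_sub: "z \<in> septic_root ` {1..<8}" if "z \<in># A" for z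
  proof -
    have "poly f z = 0" unfolding A(2) poly_prod_mset using that by (auto simp: prod_mset_zero_iff)
    then show ?thesis using septic_zeros zeros by blast
  qed
  define B where "B = image_mset (inv_into {1..<8} septic_root) A"
  have "image_mset septic_root B = image_mset (\<lambda>z. z) A"
    unfolding B_def multiset.map_comp using f_inv_into_f[OF A_sub] by (intro image_mset_cong) (simp del: atLeastLessThan_iff One_nat_def)
  then have B: "image_mset septic_root B = A" by simp
  have "set_mset B \<subseteq> {1..<8}" unfolding B_def using inv_into_into[OF A_sub] by auto
  obtain ns where ns: "mset ns = B" by (metis ex_mset)
  show thesis
  proof (rule that)
    show "set ns \<subseteq> {1..<8}" using \<open>set_mset B \<subseteq> _\<close> ns by auto
    show "length ns = Polynomial.degree f" using A(1) B ns by (metis size_image_mset size_mset)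
    show "f = (\<Prod>i\<leftarrow>ns. [:-septic_root i, 1:])"
      unfolding A(2) B[symmetric] ns[symmetric] by (simp add: prod_mset_prod_list comp_def flip: mset_map)
  qed
qed

text \<open>By factorization the cubic is a product over three roots of the septic, and their sum is
  \<open>v\<^sup>2 + 2 v - 2\<close>. The numerical comparison leaves the three roots of one line.\<close>
lemma incident_iff:
  assumes k: "k \<in> {1..<8}" and m: "m \<in> {1..<8}"
  shows "poly (cubic (dual_root k)) (septic_root m) = 0 \<longleftrightarrow> incident k m"
proof -
  let ?v = "dual_root k"
  have lead: "Polynomial.degree (cubic ?v) = 3" "Polynomial.lead_coeff (cubic ?v) = 1"
    "Polynomial.coeff (cubic ?v) 2 = - (?v^2 + 2 * ?v - 2)"
    by (simp_all add: cubic_def eval_nat_numeral algebra_simps)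
  from septic_divisor_split[of "cubic ?v"] lead septic_factorization[OF poly_dual_root[OF k]]
  obtain ns where ns: "set ns \<subseteq> {1..<8}" "length ns = 3" "cubic ?v = (\<Prod>i\<leftarrow>ns. [:-septic_root i, 1:])"
    by (metis mult_zero_left poly_mult)
  then obtain i j l where s: "ns = [i, j, l]" by (auto simp: numeral_3_eq_3 length_Suc_conv)
  have mem: "i \<in> {1..<8}" "j \<in> {1..<8}" "l \<in> {1..<8}" using s ns(1) by auto
  have eq: "cubic ?v = [:-septic_root i, 1:] * [:-septic_root j, 1:] * [:-septic_root l, 1:]"
    unfolding ns(3) s by (simp only: list.map prod_list.Cons prod_list.Nil mult_1_right mult.assoc)
  have sum: "septic_root i + septic_root j + septic_root l = ?v^2 + 2 * ?v - 2"
    using lead(3) unfolding eq by (simp add: eval_nat_numeral algebra_simps)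
  have lt: "i < 8" "j < 8" "l < 8" using mem by auto
  have bd: "list_all (\<lambda>k. \<bar>dual_re k\<bar> \<le> 20000 \<and> \<bar>dual_im k\<bar> \<le> 20000) [0..<8]" by code_simp
  have "k < 8" using k by simp
  have "close 30 (?v^2 + 2 * ?v - 2) (root_re i + root_re j + root_re l) (root_im i + root_im j + root_im l)"
    using close_add[OF close_add[OF close_septic_root[OF lt(1)] close_septic_root[OF lt(2)]] close_septic_root[OF lt(3)]]
    unfolding sum by simp
  note quad = close_quadratic[OF close_dual_root[OF k] conjunct1[OF all_less_8[OF bd \<open>k < 8\<close>]]
      conjunct2[OF all_less_8[OF bd \<open>k < 8\<close>]] this]
  \<comment> \<open>The tables are off by at most 200 + 50 units.\<close>
  have near: "\<bar>10000 * a - t\<bar> \<le> 2000000 \<Longrightarrow> \<bar>10000 * b - t\<bar> \<le> 500000 \<Longrightarrow> \<bar>a - b\<bar> \<le> 300" for a b t :: int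
    by linarith
  have approx: "\<bar>10000 * line_sum_re k - ((dual_re k)^2 - (dual_im k)^2 + 20000 * dual_re k - 200000000)\<bar> \<le> 500000
     \<and> \<bar>10000 * line_sum_im k - (2 * dual_re k * dual_im k + 20000 * dual_im k)\<bar> \<le> 500000"
    using line_sum_approx[OF \<open>k < 8\<close>] k by auto
  have "\<bar>root_re i + root_re j + root_re l - line_sum_re k\<bar> \<le> 300"
       "\<bar>root_im i + root_im j + root_im l - line_sum_im k\<bar> \<le> 300"
    using near[OF conjunct1[OF quad] conjunct1[OF approx]] near[OF conjunct2[OF quad] conjunct2[OF approx]] by auto
  from line_sum_unique[OF k mem m this]
  have "incident k m \<longleftrightarrow> m = i \<or> m = j \<or> m = l" .
  also have "\<dots> \<longleftrightarrow> poly (cubic ?v) (septic_root m) = 0"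
    unfolding eq poly_mult using inj_onD[OF inj_septic_root, of m] m lt by auto
  finally show ?thesis by simp
qed

section \<open>Irreducibility\<close>

text \<open>The second highest coefficient of such a factor is the negative sum of one, two or three roots.\<close>
lemma no_small_int_factor:
  fixes f g :: "int poly"
  assumes fg: "f * g = septic" and monic: "Polynomial.lead_coeff f = 1" and deg: "0 < Polynomial.degree f" "Polynomial.degree f \<le> 3"
  shows False
proof -
  let ?f = "map_poly of_int f :: complex poly"
  have map_mult: "(map_poly of_int (a * b) :: complex poly) = map_poly of_int a * map_poly of_int b" for a b :: "int poly"
    by (intro poly_eqI) (simp add: coeff_map_poly coeff_mult)
  have sep: "(map_poly of_int (septic :: int poly) :: complex poly) = septic"
    by (simp add: septic_def map_poly_pCons)
  have deg_eq: "Polynomial.degree ?f = Polynomial.degree f" by (rule degree_map_poly) auto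
  have "Polynomial.lead_coeff ?f = 1" by (simp add: deg_eq coeff_map_poly monic)
  moreover have "poly septic z = 0" if "poly ?f z = 0" for z
    using that unfolding sep[symmetric] fg[symmetric] map_mult by simp
  ultimately obtain ns where ns: "set ns \<subseteq> {1..<8}" "length ns = Polynomial.degree f"
    "?f = (\<Prod>i\<leftarrow>ns. [:-septic_root i, 1:])"
    using septic_divisor_split[of ?f] deg_eq by metis
  have int: "Polynomial.coeff ?f n \<in> \<int>" for n by (simp add: coeff_map_poly)
  from deg have "Polynomial.degree f = 1 \<or> Polynomial.degree f = 2 \<or> Polynomial.degree f = 3" by linarith
  then show False
  proof (elim disjE)
    assume "Polynomial.degree f = 1"
    with ns(2) obtain i where i: "ns = [i]" by (auto simp: length_Suc_conv)
    have "septic_root i + septic_root 0 + septic_root 0 \<in> \<int>"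
      using int[of 0] unfolding ns(3) i by simp
    then show False using sum_roots_not_Ints[of i 0 0] ns(1) i by simp
  next
    assume "Polynomial.degree f = 2"
    with ns(2) obtain i j where i: "ns = [i, j]" by (auto simp: length_Suc_conv numeral_2_eq_2)
    have "- (septic_root i + septic_root j) \<in> \<int>"
      using int[of 1] unfolding ns(3) i by (simp add: algebra_simps)
    then have "septic_root i + septic_root j \<in> \<int>" by (simp only: minus_in_Ints_iff)
    then show False using sum_roots_not_Ints[of i j 0] ns(1) i by simp
  next
    assume "Polynomial.degree f = 3"
    with ns(2) obtain i j l where i: "ns = [i, j, l]" by (auto simp: length_Suc_conv numeral_3_eq_3)
    have "- (septic_root i + septic_root j + septic_root l) \<in> \<int>"
      using int[of 2] unfolding ns(3) i by (simp add: eval_nat_numeral algebra_simps)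
    then have "septic_root i + septic_root j + septic_root l \<in> \<int>" by (simp only: minus_in_Ints_iff)
    then show False using sum_roots_not_Ints[of i j l] ns(1) i by simp
  qed
qed

text \<open>Of two factors one has degree at most three; its leading coefficient is a unit.\<close>
lemma irreducible_septic_int: "Factorial_Ring.irreducible (septic :: int poly)"
proof (rule comm_semiring_1_class.irreducibleI)
  show "(septic :: int poly) \<noteq> 0" by (simp add: septic_def)
  show "\<not> (septic :: int poly) dvd 1"
    using dvd_imp_degree_le[of "septic :: int poly" 1] by auto
next
  have small: "f dvd 1" if "f * g = septic" "Polynomial.degree f \<le> 3" for f g :: "int poly"
  proof -
    have "Polynomial.lead_coeff f * Polynomial.lead_coeff g = 1"
      using lead_septic(1)[where ?'a = int] degree_septic(1)[where ?'a = int]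
      unfolding that(1)[symmetric] by (metis lead_coeff_mult)
    then consider "Polynomial.lead_coeff f = 1" | "Polynomial.lead_coeff f = -1"
      by (metis zmult_eq_1_iff)
    then have "\<not> 0 < Polynomial.degree f"
    proof cases
      case 1
      with no_small_int_factor that show ?thesis by blast
    next
      case 2
      have "(-f) * (-g) = septic" using that(1) by simp
      from no_small_int_factor[OF this] 2 that(2) show ?thesis by auto
    qed
    then obtain c where c: "f = [:c:]" using degree_eq_zeroE by auto
    with \<open>Polynomial.lead_coeff f * Polynomial.lead_coeff g = 1\<close> have "c dvd 1" by (metis coeff_pCons_0 degree_pCons_0 dvdI)
    then show "f dvd 1" unfolding c by (simp add: is_unit_const_poly_iff)
  qed
  fix f g :: "int poly"
  assume fg: "septic = f * g"
  then have nz: "f \<noteq> 0" "g \<noteq> 0" by (auto simp: septic_def)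
  have "Polynomial.degree f + Polynomial.degree g = 7"
    using degree_mult_eq[OF nz] degree_septic(1)[where ?'a = int] fg by simp
  then show "f dvd 1 \<or> g dvd 1"
    using small[of f g] small[of g f] fg by (cases "Polynomial.degree f \<le> 3") (auto simp: mult.commute)
qed

lemma clear_denominators:
  fixes q :: "rat poly"
  shows "\<exists>c Q. c \<noteq> 0 \<and> Polynomial.smult (of_int c) q = map_poly of_int Q"
proof (induction q)
  case 0
  show ?case by (intro exI[of _ 1] exI[of _ 0]) simp
next
  case (pCons a q)
  then obtain c Q where cQ: "c \<noteq> 0" "Polynomial.smult (of_int c) q = map_poly of_int Q" by blast
  obtain n d where nd: "quotient_of a = (n, d)" by fastforce
  then have a: "a = of_int n / of_int d" and d: "d > 0" by (auto intro: quotient_of_div quotient_of_denom_pos)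
  have Q: "Polynomial.smult (of_int d) (map_poly of_int Q) = (map_poly of_int (Polynomial.smult d Q) :: rat poly)"
    by (intro poly_eqI) (simp add: coeff_map_poly)
  have "Polynomial.smult (of_int (d * c)) (pCons a q) = pCons (of_int (n * c)) (Polynomial.smult (of_int d) (Polynomial.smult (of_int c) q))"
    using d by (simp add: a)
  also have "\<dots> = map_poly of_int (pCons (n * c) (Polynomial.smult d Q))"
    unfolding cQ(2) Q by (simp add: map_poly_pCons)
  finally show ?case using cQ(1) d by (intro exI[of _ "d * c"] exI[of _ "pCons (n * c) (Polynomial.smult d Q)"]) simp
qed

text \<open>Pseudo-division by a vanishing polynomial of least degree leaves no remainder. It therefore divides a
  constant multiple of the septic, which is prime in \<open>\<int>[x]\<close>.\<close>
lemma int_poly_root_degree: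
  fixes Q :: "int poly"
  assumes "Q \<noteq> 0" "poly (map_poly of_int Q) z = 0" "poly septic (z::complex) = 0"
  shows "7 \<le> Polynomial.degree Q"
  using assms(1,2)
proof (induction "Polynomial.degree Q" arbitrary: Q rule: less_induct)
  case less
  obtain A R where AR: "pseudo_divmod septic Q = (A, R)" by fastforce
  define c where "c = Polynomial.lead_coeff Q ^ (Suc (Polynomial.degree (septic::int poly)) - Polynomial.degree Q)"
  have c: "c \<noteq> 0" using less.prems by (simp add: c_def)
  from pseudo_divmod[OF less.prems(1) AR]
  have div: "Polynomial.smult c septic = Q * A + R" and R: "R = 0 \<or> Polynomial.degree R < Polynomial.degree Q"
    by (simp_all add: c_def)
  have sep: "(map_poly of_int (septic :: int poly) :: complex poly) = septic"
    by (simp add: septic_def map_poly_pCons)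
  have hom: "(map_poly of_int (a * b) :: complex poly) = map_poly of_int a * map_poly of_int b"
     "(map_poly of_int (a + b) :: complex poly) = map_poly of_int a + map_poly of_int b"
     "(map_poly of_int (Polynomial.smult d a) :: complex poly) = Polynomial.smult (of_int d) (map_poly of_int a)"  for a b :: "int poly" and d
    by (intro poly_eqI; simp add: coeff_map_poly coeff_mult)+
  from arg_cong[OF div, of "\<lambda>p. poly (map_poly of_int p) z"] less.prems(2) assms(3)
  have "poly (map_poly of_int R) z = 0" by (simp add: hom sep)
  show ?case
  proof (cases "R = 0")
    case False
    with less.hyps[of R] R \<open>poly (map_poly of_int R) z = 0\<close> show ?thesis by auto
  next
    case True
    have prime: "prime_elem (septic :: int poly)" using irreducible_septic_int by (rule irreducible_imp_prime_elem)
    have "septic dvd Q * A" using div True by (metis add_0_right dvd_refl dvd_smult)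
    with prime have "septic dvd Q \<or> septic dvd A" by (rule prime_elem_dvd_multD)
    then show ?thesis
    proof
      assume "septic dvd Q"
      from dvd_imp_degree_le[OF this less.prems(1)] show ?thesis by simp
    next
      assume "septic dvd A"
      then obtain B where "A = septic * B" by (auto elim: dvdE)
      with div True have "septic * [:c:] = septic * (Q * B)" by (simp add: mult.left_commute)
      moreover have "(septic :: int poly) \<noteq> 0" using prime by auto
      ultimately have QB: "[:c:] = Q * B" using mult_left_cancel by blast
      from arg_cong[OF this, of "\<lambda>p. poly (map_poly of_int p) z"] less.prems(2) c
      show ?thesis by (simp add: hom map_poly_pCons)
    qed
  qed
qed

lemma rat_poly_root_degree:
  fixes q :: "rat poly"
  assumes "q \<noteq> 0" "poly (map_poly of_rat q) z = 0" "poly septic (z::complex) = 0"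
  shows "7 \<le> Polynomial.degree q"
proof -
  obtain c Q where cQ: "c \<noteq> 0" "Polynomial.smult (of_int c) q = map_poly of_int Q" using clear_denominators by blast
  have deg: "Polynomial.degree (map_poly rat_of_int Q) = Polynomial.degree Q" by (rule degree_map_poly) auto
  have "Q \<noteq> 0" using cQ assms(1) by auto
  have "(map_poly of_int Q :: complex poly) = map_poly of_rat (map_poly of_int Q)"
    by (intro poly_eqI) (simp add: coeff_map_poly)
  also have "\<dots> = Polynomial.smult (of_int c) (map_poly of_rat q)"
    unfolding cQ(2)[symmetric] by (intro poly_eqI) (simp add: coeff_map_poly of_rat_mult)
  finally have "poly (map_poly of_int Q) z = 0" using assms(2) by simp
  from int_poly_root_degree[OF \<open>Q \<noteq> 0\<close> this assms(3)] show ?thesis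
    using deg cQ by (metis degree_smult_eq of_int_eq_0_iff)
qed

section \<open>Extending embeddings of subfields of the complex numbers\<close>

text \<open>All fields are sets of complex numbers, so that extension steps stay inside one type and every
  transported minimal polynomial has a root to serve as an image.\<close>
definition is_subfield :: "complex set \<Rightarrow> bool" where
  "is_subfield F \<longleftrightarrow> 1 \<in> F \<and> (\<forall>x\<in>F. \<forall>y\<in>F. x - y \<in> F \<and> x * y \<in> F) \<and> (\<forall>x\<in>F. inverse x \<in> F)"

definition field_hom :: "complex set \<Rightarrow> (complex \<Rightarrow> complex) \<Rightarrow> bool" where
  "field_hom F \<sigma> \<longleftrightarrow> \<sigma> 1 = 1 \<and> (\<forall>x\<in>F. \<forall>y\<in>F. \<sigma> (x + y) = \<sigma> x + \<sigma> y \<and> \<sigma> (x * y) = \<sigma> x * \<sigma> y)"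

definition polys_over :: "complex set \<Rightarrow> complex poly set" where
  "polys_over F = {q. \<forall>i. Polynomial.coeff q i \<in> F}"

lemma subfield_closed:
  assumes "is_subfield F"
  shows subfield_1: "1 \<in> F" and subfield_0: "0 \<in> F"
    and subfield_diff: "x \<in> F \<Longrightarrow> y \<in> F \<Longrightarrow> x - y \<in> F"
    and subfield_mult: "x \<in> F \<Longrightarrow> y \<in> F \<Longrightarrow> x * y \<in> F"
    and subfield_inverse: "x \<in> F \<Longrightarrow> inverse x \<in> F"
    and subfield_uminus: "x \<in> F \<Longrightarrow> - x \<in> F"
    and subfield_add: "x \<in> F \<Longrightarrow> y \<in> F \<Longrightarrow> x + y \<in> F"
proof -
  have *: "1 \<in> F" "\<And>x y. x \<in> F \<Longrightarrow> y \<in> F \<Longrightarrow> x - y \<in> F" "\<And>x y. x \<in> F \<Longrightarrow> y \<in> F \<Longrightarrow> x * y \<in> F"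
    "\<And>x. x \<in> F \<Longrightarrow> inverse x \<in> F" using assms by (auto simp: is_subfield_def)
  show 0: "0 \<in> F" using *(2)[OF *(1) *(1)] by simp
  show m: "- x \<in> F" if "x \<in> F" for x using *(2)[OF 0 that] by simp
  show "x + y \<in> F" if "x \<in> F" "y \<in> F" for x y using *(2)[OF that(1) m[OF that(2)]] by simp
qed (use assms in \<open>auto simp: is_subfield_def\<close>)

lemma subfield_sum: "is_subfield F \<Longrightarrow> (\<And>i. i \<in> A \<Longrightarrow> f i \<in> F) \<Longrightarrow> (\<Sum>i\<in>A. f i) \<in> F"
  by (induction A rule: infinite_finite_induct) (auto intro: subfield_0 subfield_add)

lemma subfield_of_nat: "is_subfield F \<Longrightarrow> of_nat n \<in> F"
  by (induction n) (auto intro: subfield_0 subfield_add subfield_1)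

lemma subfield_of_int: "is_subfield F \<Longrightarrow> of_int n \<in> F"
  by (cases n rule: int_cases2) (auto intro: subfield_of_nat subfield_uminus)

lemma subfield_of_rat: "is_subfield F \<Longrightarrow> of_rat r \<in> F"
  by (cases r) (auto simp: of_rat_rat divide_inverse intro!: subfield_mult subfield_inverse subfield_of_int)

lemma subfield_Rats: "is_subfield \<rat>"
  by (auto simp: is_subfield_def intro: Rats_mult Rats_diff Rats_inverse)

lemma field_hom_simps:
  assumes "is_subfield F" "field_hom F \<sigma>"
  shows field_hom_1: "\<sigma> 1 = 1" and field_hom_0: "\<sigma> 0 = 0"
    and field_hom_add: "x \<in> F \<Longrightarrow> y \<in> F \<Longrightarrow> \<sigma> (x + y) = \<sigma> x + \<sigma> y"
    and field_hom_mult: "x \<in> F \<Longrightarrow> y \<in> F \<Longrightarrow> \<sigma> (x * y) = \<sigma> x * \<sigma> y"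
    and field_hom_uminus: "x \<in> F \<Longrightarrow> \<sigma> (- x) = - \<sigma> x"
    and field_hom_diff: "x \<in> F \<Longrightarrow> y \<in> F \<Longrightarrow> \<sigma> (x - y) = \<sigma> x - \<sigma> y"
    and field_hom_eq_0_iff: "x \<in> F \<Longrightarrow> \<sigma> x = 0 \<longleftrightarrow> x = 0"
    and field_hom_inverse: "x \<in> F \<Longrightarrow> \<sigma> (inverse x) = inverse (\<sigma> x)"
proof -
  note cl = subfield_closed[OF assms(1)]
  show 1: "\<sigma> 1 = 1" using assms(2) by (auto simp: field_hom_def)
  show a: "\<sigma> (x + y) = \<sigma> x + \<sigma> y" if "x \<in> F" "y \<in> F" for x y using assms(2) that by (auto simp: field_hom_def)
  show m: "\<sigma> (x * y) = \<sigma> x * \<sigma> y" if "x \<in> F" "y \<in> F" for x y using assms(2) that by (auto simp: field_hom_def)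
  show 0: "\<sigma> 0 = 0" using a[OF cl(2) cl(2)] by simp
  show u: "\<sigma> (- x) = - \<sigma> x" if "x \<in> F" for x using a[OF that cl(6)[OF that]] 0 by (simp add: eq_neg_iff_add_eq_0 add.commute)
  show "\<sigma> (x - y) = \<sigma> x - \<sigma> y" if "x \<in> F" "y \<in> F" for x y using a[OF that(1) cl(6)[OF that(2)]] u that by simp
  have inv: "\<sigma> x * \<sigma> (inverse x) = 1" if "x \<in> F" "x \<noteq> 0" for x
    using m[OF that(1) cl(5)[OF that(1)]] that 1 by simp
  show "\<sigma> x = 0 \<longleftrightarrow> x = 0" if "x \<in> F" for x
    using 0 inv[OF that] by (metis mult_zero_left zero_neq_one)
  show "\<sigma> (inverse x) = inverse (\<sigma> x)" if "x \<in> F" for x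
    using inv[OF that] 0 by (cases "x = 0") (auto intro: inverse_unique[symmetric])
qed

lemma field_hom_sum:
  assumes "is_subfield F" "field_hom F \<sigma>" "\<And>i. i \<in> A \<Longrightarrow> f i \<in> F"
  shows "\<sigma> (\<Sum>i\<in>A. f i) = (\<Sum>i\<in>A. \<sigma> (f i))"
  using assms(3)
  by (induction A rule: infinite_finite_induct)
     (auto simp: field_hom_0[OF assms(1,2)] field_hom_add[OF assms(1,2)] subfield_sum[OF assms(1)])

lemma field_hom_of_nat: "is_subfield F \<Longrightarrow> field_hom F \<sigma> \<Longrightarrow> \<sigma> (of_nat n) = of_nat n"
  by (induction n) (auto simp: field_hom_0 field_hom_1 field_hom_add subfield_1 subfield_of_nat)

lemma field_hom_of_int: "is_subfield F \<Longrightarrow> field_hom F \<sigma> \<Longrightarrow> \<sigma> (of_int n) = of_int n"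
  by (cases n rule: int_cases2) (simp_all add: field_hom_of_nat field_hom_uminus subfield_of_nat)

lemma field_hom_of_rat: "is_subfield F \<Longrightarrow> field_hom F \<sigma> \<Longrightarrow> \<sigma> (of_rat r) = of_rat r"
  by (cases r) (simp add: of_rat_rat divide_inverse field_hom_mult field_hom_inverse subfield_of_int
      subfield_inverse field_hom_of_int)

lemma polys_over_closed:
  assumes "is_subfield F"
  shows "0 \<in> polys_over F" "p \<in> polys_over F \<Longrightarrow> q \<in> polys_over F \<Longrightarrow> p + q \<in> polys_over F"
    "p \<in> polys_over F \<Longrightarrow> q \<in> polys_over F \<Longrightarrow> p - q \<in> polys_over F"
    "p \<in> polys_over F \<Longrightarrow> q \<in> polys_over F \<Longrightarrow> p * q \<in> polys_over F"
    "c \<in> F \<Longrightarrow> p \<in> polys_over F \<Longrightarrow> Polynomial.smult c p \<in> polys_over F"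
    "c \<in> F \<Longrightarrow> Polynomial.monom c n \<in> polys_over F"
    "c \<in> F \<Longrightarrow> p \<in> polys_over F \<Longrightarrow> pCons c p \<in> polys_over F"
  unfolding polys_over_def coeff_mult
  by (auto intro!: subfield_closed[OF assms] subfield_sum[OF assms] simp: coeff_mult coeff_pCons split: nat.splits)

lemma poly_in_subfield:
  assumes "is_subfield F" "q \<in> polys_over F" "a \<in> F"
  shows "poly q a \<in> F"
proof -
  have "a ^ n \<in> F" for n by (induction n) (auto intro: subfield_closed[OF assms(1)] assms(3))
  then show ?thesis
    using assms(2) unfolding poly_altdef polys_over_def
    by (auto intro!: subfield_sum[OF assms(1)] subfield_mult[OF assms(1)])
qed

lemma map_poly_hom:
  assumes "is_subfield F" "field_hom F \<sigma>" "p \<in> polys_over F"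
  shows "q \<in> polys_over F \<Longrightarrow> map_poly \<sigma> (p + q) = map_poly \<sigma> p + map_poly \<sigma> q"
    and "q \<in> polys_over F \<Longrightarrow> map_poly \<sigma> (p - q) = map_poly \<sigma> p - map_poly \<sigma> q"
    and "q \<in> polys_over F \<Longrightarrow> map_poly \<sigma> (p * q) = map_poly \<sigma> p * map_poly \<sigma> q"
proof -
  note [simp] = coeff_map_poly[where f = \<sigma>, OF field_hom_0[OF assms(1,2)]]
  assume q: "q \<in> polys_over F"
  with assms(3) have c: "Polynomial.coeff p i \<in> F" "Polynomial.coeff q i \<in> F" for i by (auto simp: polys_over_def)
  show "map_poly \<sigma> (p + q) = map_poly \<sigma> p + map_poly \<sigma> q"
    by (intro poly_eqI) (simp add: field_hom_add[OF assms(1,2)] c)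
  show "map_poly \<sigma> (p - q) = map_poly \<sigma> p - map_poly \<sigma> q"
    by (intro poly_eqI) (simp add: field_hom_diff[OF assms(1,2)] c)
  show "map_poly \<sigma> (p * q) = map_poly \<sigma> p * map_poly \<sigma> q"
    by (intro poly_eqI) (simp add: coeff_mult field_hom_sum[OF assms(1,2)] field_hom_mult[OF assms(1,2)]
        subfield_mult[OF assms(1)] c)
qed

lemma field_hom_poly:
  assumes "is_subfield F" "field_hom F \<sigma>" "q \<in> polys_over F" "a \<in> F"
  shows "\<sigma> (poly q a) = poly (map_poly \<sigma> q) (\<sigma> a)"
  using assms(3)
proof (induction q)
  case 0
  show ?case by (simp add: field_hom_0[OF assms(1,2)])
next
  case (pCons c q)
  have *: "c \<in> F" "q \<in> polys_over F"
    using pCons.prems by (auto simp: polys_over_def coeff_pCons split: nat.splits dest: spec[of _ 0] spec[of _ "Suc _"])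
  show ?case
    using pCons.IH[OF *(2)] *  assms(4) pCons.hyps poly_in_subfield[OF assms(1) *(2) assms(4)]
    by (simp add: field_hom_add[OF assms(1,2)] field_hom_mult[OF assms(1,2)] subfield_mult[OF assms(1)]
        map_poly_pCons field_hom_0[OF assms(1,2)])
qed

text \<open>Division by a monic polynomial does not leave the coefficient field.\<close>
lemma monic_division:
  assumes F: "is_subfield F" and m: "m \<in> polys_over F" "Polynomial.lead_coeff m = 1" and q: "q \<in> polys_over F"
  shows "\<exists>t\<in>polys_over F. \<exists>r\<in>polys_over F. q = m * t + r \<and> (r = 0 \<or> Polynomial.degree r < Polynomial.degree m)"
  using q
proof (induction "Polynomial.degree q" arbitrary: q rule: less_induct)
  case less
  note cl = polys_over_closed[OF F]
  show ?case
  proof (cases "q = 0 \<or> Polynomial.degree q < Polynomial.degree m")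
    case True
    then show ?thesis using cl(1) less.prems by (intro bexI[of _ 0] bexI[of _ q]) auto
  next
    case False
    define u where "u = Polynomial.monom (Polynomial.lead_coeff q) (Polynomial.degree q - Polynomial.degree m)"
    have u: "u \<in> polys_over F" unfolding u_def using less.prems by (intro cl(6)) (auto simp: polys_over_def)
    have "u \<noteq> 0" "m \<noteq> 0" using False m(2) by (auto simp: u_def)
    have "Polynomial.lead_coeff q \<noteq> 0" using False by auto
    from Polynomial.degree_monom_eq[OF this]
    have "Polynomial.degree u = Polynomial.degree q - Polynomial.degree m" unfolding u_def .
    then have "Polynomial.lead_coeff u = Polynomial.lead_coeff q" by (simp add: u_def)
    then have lead: "Polynomial.lead_coeff (m * u) = Polynomial.lead_coeff q"
      unfolding lead_coeff_mult m(2) by simp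
    from \<open>Polynomial.degree u = _\<close> degree_mult_eq[OF \<open>m \<noteq> 0\<close> \<open>u \<noteq> 0\<close>] False
    have deg: "Polynomial.degree (m * u) = Polynomial.degree q" by simp
    let ?q = "q - m * u"
    have q': "?q \<in> polys_over F" by (intro cl less.prems m u)
    have "Polynomial.degree ?q \<le> Polynomial.degree q" by (intro degree_diff_le) (simp_all add: deg)
    moreover have "Polynomial.coeff ?q (Polynomial.degree q) = 0" using lead deg by simp
    ultimately have "Polynomial.degree ?q < Polynomial.degree q \<or> ?q = 0" by (metis eq_zero_or_degree_less)
    then show ?thesis
    proof
      assume "Polynomial.degree ?q < Polynomial.degree q"
      from less.hyps[OF this q'] obtain t r where "t \<in> polys_over F" "r \<in> polys_over F" "?q = m * t + r"
        "r = 0 \<or> Polynomial.degree r < Polynomial.degree m" by blast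
      moreover have "q = m * (u + t) + r"
        using \<open>?q = m * t + r\<close> by (metis add.assoc add_diff_cancel_left' diff_add_cancel distrib_left add.commute)
      ultimately show ?thesis using cl(2)[OF u] by blast
    next
      assume "?q = 0"
      then have "q = m * u + 0" by simp
      then show ?thesis using u cl(1) by blast
    qed
  qed
qed

text \<open>Every element of \<open>F[a]\<close> is \<open>q(a)\<close> for some \<open>q\<close> over \<open>F\<close>, and \<open>\<tau>\<close> sends it to the value of the transported polynomial at \<open>b\<close>. This is well
  defined, because \<open>m\<close> divides every polynomial over \<open>F\<close> that vanishes at \<open>a\<close>. That \<open>F[a]\<close> has inverses follows
  from minimality of the degree of \<open>m\<close> by Euclid's algorithm.\<close>
lemma adjoin_root:
  assumes F: "is_subfield F" and \<sigma>: "field_hom F \<sigma>"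
    and m: "m \<in> polys_over F" "Polynomial.lead_coeff m = 1" "poly m a = 0"
    and min: "\<And>q. q \<in> polys_over F \<Longrightarrow> poly q a = 0 \<Longrightarrow> q \<noteq> 0 \<Longrightarrow> Polynomial.degree m \<le> Polynomial.degree q"
    and b: "poly (map_poly \<sigma> m) b = 0"
  shows "\<exists>F' \<tau>. is_subfield F' \<and> F \<subseteq> F' \<and> a \<in> F' \<and> field_hom F' \<tau> \<and> (\<forall>x\<in>F. \<tau> x = \<sigma> x) \<and> \<tau> a = b"
proof -
  note cl = polys_over_closed[OF F] and hom = map_poly_hom[OF F \<sigma>] and dv = monic_division[OF F]
  define F' where "F' = (\<lambda>q. poly q a) ` polys_over F"
  have vanish: "poly (map_poly \<sigma> q) b = 0" if q: "q \<in> polys_over F" "poly q a = 0" for q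
  proof -
    obtain t r where tr: "t \<in> polys_over F" "r \<in> polys_over F" "q = m * t + r" "r = 0 \<or> Polynomial.degree r < Polynomial.degree m"
      using dv[OF m(1,2) q(1)] by blast
    have "poly r a = 0" using q(2) m(3) unfolding tr(3) by simp
    with min[OF tr(2)] tr(4) have "r = 0" by fastforce
    then show ?thesis using b tr(1) m(1) unfolding tr(3) by (simp add: hom(3))
  qed
  have wd: "poly (map_poly \<sigma> p) b = poly (map_poly \<sigma> q) b"
    if "p \<in> polys_over F" "q \<in> polys_over F" "poly p a = poly q a" for p q
    using vanish[OF cl(3)[OF that(1,2)]] that by (simp add: hom(2))
  define \<tau> where "\<tau> x = poly (map_poly \<sigma> (SOME q. q \<in> polys_over F \<and> poly q a = x)) b" for x
  have \<tau>: "\<tau> (poly q a) = poly (map_poly \<sigma> q) b" if "q \<in> polys_over F" for q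
    unfolding \<tau>_def using someI[of "\<lambda>p. p \<in> polys_over F \<and> poly p a = poly q a" q] that
    by (intro wd) auto
  have inv: "\<exists>s\<in>polys_over F. poly s a * poly q a = 1" if "q \<in> polys_over F" "poly q a \<noteq> 0" for q
    using that
  proof (induction "Polynomial.degree q" arbitrary: q rule: less_induct)
    case less
    have "q \<noteq> 0" using less.prems by auto
    show ?case
    proof (cases "Polynomial.degree q = 0")
      case True
      then obtain c where c: "q = [:c:]" using degree_eq_zeroE by blast
      with less.prems have "c \<in> F" "c \<noteq> 0" by (auto simp: polys_over_def dest: spec[of _ 0])
      then show ?thesis unfolding c by (intro bexI[of _ "[:inverse c:]"]) (auto intro!: cl subfield_inverse[OF F])
    next
      case nonconst: False
      define c where "c = inverse (Polynomial.lead_coeff q)"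
      have c: "c \<in> F" "c \<noteq> 0" using less.prems(1) \<open>q \<noteq> 0\<close> by (auto simp: c_def polys_over_def intro: subfield_inverse[OF F])
      let ?q = "Polynomial.smult c q"
      have q': "?q \<in> polys_over F" "Polynomial.lead_coeff ?q = 1" "Polynomial.degree ?q = Polynomial.degree q"
        using cl(5)[OF c(1) less.prems(1)] \<open>q \<noteq> 0\<close> c(2) by (auto simp: c_def)
      show ?thesis
      proof (cases "Polynomial.degree q < Polynomial.degree m")
        case True
        obtain t r where tr: "t \<in> polys_over F" "r \<in> polys_over F" "m = ?q * t + r" "r = 0 \<or> Polynomial.degree r < Polynomial.degree q"
          using dv[OF q'(1,2) m(1)] q'(3) by auto
        have eq: "c * poly q a * poly t a + poly r a = 0" using m(3) unfolding tr(3) by (simp add: mult.assoc)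
        \<comment> \<open>Otherwise \<open>q\<close> or its cofactor would vanish at \<open>a\<close> and have smaller degree than \<open>m\<close>.\<close>
        have "poly r a \<noteq> 0"
        proof
          assume ra: "poly r a = 0"
          with min[OF tr(2)] tr(4) True have "r = 0" by fastforce
          from eq ra c less.prems(2) have ta: "poly t a = 0" by simp
          have "t \<noteq> 0" using m(2) tr(3) \<open>r = 0\<close> by auto
          then have "Polynomial.degree m = Polynomial.degree q + Polynomial.degree t"
            unfolding tr(3) \<open>r = 0\<close> using \<open>q \<noteq> 0\<close> c(2) by (simp add: degree_mult_eq)
          with min[OF tr(1) ta \<open>t \<noteq> 0\<close>] nonconst show False by simp
        qed
        moreover from this tr(4) have "Polynomial.degree r < Polynomial.degree q" by auto
        ultimately obtain s where s: "s \<in> polys_over F" "poly s a * poly r a = 1"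
          using less.hyps[OF _ tr(2)] by blast
        have "poly (Polynomial.smult (- c) (s * t)) a * poly q a = poly s a * (- (c * poly q a * poly t a))"
          by (simp add: algebra_simps)
        also have "- (c * poly q a * poly t a) = poly r a" using eq by (simp add: add_eq_0_iff)
        finally have "poly (Polynomial.smult (- c) (s * t)) a * poly q a = 1" using s(2) by simp
        then show ?thesis
          using cl(5)[OF subfield_uminus[OF F c(1)] cl(4)[OF s(1) tr(1)]] by blast
      next
        case False
        obtain t r where tr: "t \<in> polys_over F" "r \<in> polys_over F" "q = m * t + r" "r = 0 \<or> Polynomial.degree r < Polynomial.degree m"
          using dv[OF m(1,2) less.prems(1)] by blast
        have ra: "poly r a = poly q a" using m(3) unfolding tr(3) by simp
        with less.prems(2) tr(4) False have "Polynomial.degree r < Polynomial.degree q" by auto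
        from less.hyps[OF this tr(2)] ra less.prems(2) show ?thesis by simp
      qed
    qed
  qed
  have "is_subfield F'"
    unfolding is_subfield_def
  proof (intro conjI ballI)
    show "1 \<in> F'" unfolding F'_def by (rule image_eqI[of _ _ "[:1:]"]) (auto intro!: cl subfield_1[OF F])
  next
    fix x y assume "x \<in> F'" "y \<in> F'"
    then obtain p q where pq: "x = poly p a" "y = poly q a" "p \<in> polys_over F" "q \<in> polys_over F" by (auto simp: F'_def)
    show "x - y \<in> F'" unfolding F'_def using pq by (intro image_eqI[of _ _ "p - q"]) (auto intro!: cl)
    show "x * y \<in> F'" unfolding F'_def using pq by (intro image_eqI[of _ _ "p * q"]) (auto intro!: cl)
  next
    fix x assume "x \<in> F'"
    then obtain q where q: "x = poly q a" "q \<in> polys_over F" by (auto simp: F'_def)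
    show "inverse x \<in> F'"
    proof (cases "x = 0")
      case True
      then show ?thesis unfolding F'_def by (intro image_eqI[of _ _ 0]) (auto intro: cl)
    next
      case False
      with inv q obtain s where "s \<in> polys_over F" "poly s a * x = 1" by blast
      then show ?thesis unfolding F'_def by (intro image_eqI[of _ _ s]) (auto intro: inverse_unique simp: mult.commute)
    qed
  qed
  moreover have const: "[:x:] \<in> polys_over F" if "x \<in> F" for x using that by (auto intro!: cl)
  have "F \<subseteq> F'"
  proof
    fix x assume "x \<in> F"
    then show "x \<in> F'" unfolding F'_def using const by (intro image_eqI[of _ _ "[:x:]"]) auto
  qed
  moreover have X: "[:0, 1:] \<in> polys_over F" by (auto intro!: cl subfield_1[OF F] subfield_0[OF F])
  then have "a \<in> F'" unfolding F'_def by (intro image_eqI[of _ _ "[:0, 1:]"]) auto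
  moreover have "field_hom F' \<tau>"
    unfolding field_hom_def
  proof (intro conjI ballI)
    show "\<tau> 1 = 1" using \<tau>[OF const[OF subfield_1[OF F]]] by (simp add: map_poly_pCons field_hom_0[OF F \<sigma>] field_hom_1[OF F \<sigma>])
  next
    fix x y assume "x \<in> F'" "y \<in> F'"
    then obtain p q where pq: "x = poly p a" "y = poly q a" "p \<in> polys_over F" "q \<in> polys_over F" by (auto simp: F'_def)
    show "\<tau> (x + y) = \<tau> x + \<tau> y" using \<tau>[OF cl(2)[OF pq(3,4)]] \<tau>[OF pq(3)] \<tau>[OF pq(4)] pq by (simp add: hom)
    show "\<tau> (x * y) = \<tau> x * \<tau> y" using \<tau>[OF cl(4)[OF pq(3,4)]] \<tau>[OF pq(3)] \<tau>[OF pq(4)] pq by (simp add: hom)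
  qed
  moreover have "\<forall>x\<in>F. \<tau> x = \<sigma> x"
  proof
    fix x assume "x \<in> F"
    from \<tau>[OF const[OF this]] show "\<tau> x = \<sigma> x" by (simp add: map_poly_pCons field_hom_0[OF F \<sigma>])
  qed
  moreover have "\<tau> a = b" using \<tau>[OF X] by (simp add: map_poly_pCons field_hom_0[OF F \<sigma>] field_hom_1[OF F \<sigma>])
  ultimately show ?thesis by blast
qed

text \<open>Any root of the transported minimal polynomial serves as the image of \<open>a\<close>.\<close>
lemma extend_hom_algebraic:
  assumes F: "is_subfield F" and \<sigma>: "field_hom F \<sigma>"
    and f: "f \<in> polys_over F" "f \<noteq> 0" "poly f a = 0"
  shows "\<exists>F' \<tau>. is_subfield F' \<and> F \<subseteq> F' \<and> a \<in> F' \<and> field_hom F' \<tau> \<and> (\<forall>x\<in>F. \<tau> x = \<sigma> x)"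
proof -
  define P where "P q \<longleftrightarrow> q \<in> polys_over F \<and> poly q a = 0 \<and> q \<noteq> 0" for q
  have "P f" using f by (simp add: P_def)
  define q where "q = arg_min Polynomial.degree P"
  have q: "P q" "\<And>g. P g \<Longrightarrow> Polynomial.degree q \<le> Polynomial.degree g"
    using arg_min_natI[of P, OF \<open>P f\<close>] arg_min_nat_le[of P _ Polynomial.degree] by (auto simp: q_def)
  define m where "m = Polynomial.smult (inverse (Polynomial.lead_coeff q)) q"
  have m: "m \<in> polys_over F" "Polynomial.lead_coeff m = 1" "poly m a = 0" "Polynomial.degree m = Polynomial.degree q"
    using q(1) unfolding P_def m_def
    by (auto intro!: subfield_mult[OF F] subfield_inverse[OF F] simp: polys_over_def)
  have "Polynomial.degree m > 0"
    using m(2,3) by (intro Nat.gr0I) (auto elim!: degree_eq_zeroE)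
  moreover have "Polynomial.degree (map_poly \<sigma> m) = Polynomial.degree m"
    by (rule map_poly_degree_eq) (simp add: m(2) field_hom_1[OF F \<sigma>])
  ultimately obtain b where b: "poly (map_poly \<sigma> m) b = 0"
    using alg_closed_imp_poly_has_root[of "map_poly \<sigma> m"] by auto
  show ?thesis
    using adjoin_root[OF F \<sigma> m(1-3) _ b] q(2) m(4) unfolding P_def by metis
qed

lemma extend_hom_finite:
  assumes "finite A" "is_subfield F" "field_hom F \<sigma>"
    and "f \<in> polys_over F" "f \<noteq> 0" "\<And>a. a \<in> A \<Longrightarrow> poly f a = 0"
  shows "\<exists>F' \<tau>. is_subfield F' \<and> F \<subseteq> F' \<and> A \<subseteq> F' \<and> field_hom F' \<tau> \<and> (\<forall>x\<in>F. \<tau> x = \<sigma> x)"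
  using assms(1,6)
proof (induction A)
  case empty
  then show ?case using assms by auto
next
  case (insert a A)
  then obtain F' \<tau> where 1: "is_subfield F'" "F \<subseteq> F'" "A \<subseteq> F'" "field_hom F' \<tau>" "\<forall>x\<in>F. \<tau> x = \<sigma> x" by auto
  have "f \<in> polys_over F'" using assms(4) 1(2) by (auto simp: polys_over_def)
  from extend_hom_algebraic[OF 1(1,4) this assms(5), of a] insert.prems
  obtain F'' \<rho> where "is_subfield F''" "F' \<subseteq> F''" "a \<in> F''" "field_hom F'' \<rho>" "\<forall>x\<in>F'. \<rho> x = \<tau> x" by auto
  with 1 show ?case by (intro exI[of _ F''] exI[of _ \<rho>]) auto
qed

section \<open>The Galois group of a rational polynomial\<close>

lemma complex_field_simps [simp]:
  "carrier complex_field = UNIV" "\<one>\<^bsub>complex_field\<^esub> = 1" "\<zero>\<^bsub>complex_field\<^esub> = 0"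
  "x \<otimes>\<^bsub>complex_field\<^esub> y = x * y" "x \<oplus>\<^bsub>complex_field\<^esub> y = x + y"
  by (simp_all add: ring_of_type_algebra_def)

lemma complex_field_field: "field complex_field"
  by (rule field_from_type_algebra)

lemma complex_field_inverses [simp]:
  "\<ominus>\<^bsub>complex_field\<^esub> x = - x" "x \<noteq> 0 \<Longrightarrow> inv\<^bsub>complex_field\<^esub> x = inverse x"
proof -
  interpret K: field complex_field by (rule complex_field_field)
  show "\<ominus>\<^bsub>complex_field\<^esub> x = - x" by (rule K.minus_equality) auto
  show "inv\<^bsub>complex_field\<^esub> x = inverse x" if "x \<noteq> 0" using that by (intro K.comm_inv_char) auto
qed

lemma is_subfield_generate: "is_subfield (generate_field complex_field Z)"
proof -
  let ?L = "generate_field complex_field Z"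
  have one: "1 \<in> ?L" using generate_field.one[of complex_field Z] by simp
  have neg: "- x \<in> ?L" if "x \<in> ?L" for x using generate_field.a_inv[OF that] by simp
  have add: "x + y \<in> ?L" if "x \<in> ?L" "y \<in> ?L" for x y using generate_field.eng_add[OF that] by simp
  have mult: "x * y \<in> ?L" if "x \<in> ?L" "y \<in> ?L" for x y using generate_field.eng_mult[OF that] by simp
  have inv: "inverse x \<in> ?L" if "x \<in> ?L" for x
    using generate_field.m_inv[OF that] that by (cases "x = 0") auto
  show ?thesis unfolding is_subfield_def
    using one mult inv add[OF _ neg] by auto
qed

lemma generate_field_least:
  assumes "is_subfield F" "Z \<subseteq> F"
  shows "generate_field complex_field Z \<subseteq> F"
proof
  fix x assume "x \<in> generate_field complex_field Z"
  then show "x \<in> F"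
    by (induction rule: generate_field.induct)
       (use assms in \<open>auto intro: subfield_closed\<close>)
qed

lemma subfield_image:
  assumes "is_subfield F" "field_hom F \<tau>"
  shows "is_subfield (\<tau> ` F)"
  unfolding is_subfield_def
proof (intro conjI ballI)
  show "1 \<in> \<tau> ` F" using field_hom_1[OF assms] subfield_1[OF assms(1)] by force
next
  fix x y assume "x \<in> \<tau> ` F" "y \<in> \<tau> ` F"
  then obtain a b where ab: "x = \<tau> a" "y = \<tau> b" "a \<in> F" "b \<in> F" by auto
  show "x - y \<in> \<tau> ` F" using ab field_hom_diff[OF assms, of a b] subfield_diff[OF assms(1), of a b] by (metis image_eqI)
  show "x * y \<in> \<tau> ` F" using ab field_hom_mult[OF assms, of a b] subfield_mult[OF assms(1), of a b] by (metis image_eqI)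
next
  fix x assume "x \<in> \<tau> ` F"
  then show "inverse x \<in> \<tau> ` F" using field_hom_inverse[OF assms] subfield_inverse[OF assms(1)] by force
qed

lemma field_hom_subset: "field_hom F \<tau> \<Longrightarrow> E \<subseteq> F \<Longrightarrow> field_hom E \<tau>"
  by (auto simp: field_hom_def)

lemma field_hom_inj_on:
  assumes "is_subfield F" "field_hom F \<tau>"
  shows "inj_on \<tau> F"
proof (rule inj_onI)
  fix x y assume xy: "x \<in> F" "y \<in> F" "\<tau> x = \<tau> y"
  then have "\<tau> (x - y) = 0" by (simp add: field_hom_diff[OF assms])
  then show "x = y" using field_hom_eq_0_iff[OF assms subfield_diff[OF assms(1) xy(1,2)]] by simp
qed

definition zeros :: "rat poly \<Rightarrow> complex set" where
  "zeros p = {z. poly (map_poly of_rat p) z = 0}"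

lemma finite_zeros: "p \<noteq> 0 \<Longrightarrow> finite (zeros p)"
  unfolding zeros_def by (rule poly_roots_finite) (auto simp: map_poly_eq_0_iff)

lemma hom_rat_poly:
  assumes "is_subfield F" "field_hom F \<tau>" "z \<in> F"
  shows "\<tau> (poly (map_poly of_rat p) z) = poly (map_poly of_rat p) (\<tau> z)"
proof -
  have "map_poly of_rat p \<in> polys_over F"
    using subfield_of_rat[OF assms(1)] by (auto simp: polys_over_def coeff_map_poly)
  moreover have "map_poly \<tau> (map_poly of_rat p) = map_poly of_rat p"
    by (intro poly_eqI) (simp add: coeff_map_poly field_hom_0[OF assms(1,2)] field_hom_of_rat[OF assms(1,2)])
  ultimately show ?thesis using field_hom_poly[OF assms(1,2) _ assms(3)] by metis
qed

abbreviation splitting_set :: "rat poly \<Rightarrow> complex set" where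
  "splitting_set p \<equiv> generate_field complex_field (zeros p)"

lemma zeros_subset: "zeros p \<subseteq> splitting_set p"
  by (auto intro: generate_field.incl)

lemma hom_zeros:
  assumes "field_hom (splitting_set p) \<tau>" "z \<in> zeros p"
  shows "\<tau> z \<in> zeros p"
  using hom_rat_poly[OF is_subfield_generate assms(1), of z p] assms(2) zeros_subset
    field_hom_0[OF is_subfield_generate assms(1)] by (auto simp: zeros_def)

text \<open>An embedding permutes the finite set of zeros. Both its image and the set of elements whose image stays in the
  splitting field are subfields that contain the zeros.\<close>
lemma hom_splitting_bij:
  assumes "p \<noteq> 0" "field_hom (splitting_set p) \<tau>"
  shows "bij_betw \<tau> (splitting_set p) (splitting_set p)"
proof -
  let ?L = "splitting_set p"
  note L = is_subfield_generate[of "zeros p"]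
  have inj: "inj_on \<tau> ?L" by (rule field_hom_inj_on[OF L assms(2)])
  have "\<tau> ` zeros p = zeros p"
    using hom_zeros[OF assms(2)] inj_on_subset[OF inj zeros_subset]
    by (intro endo_inj_surj finite_zeros assms(1)) auto
  then have "zeros p \<subseteq> \<tau> ` ?L" using zeros_subset by blast
  then have sup: "?L \<subseteq> \<tau> ` ?L" by (rule generate_field_least[OF subfield_image[OF L assms(2)]])
  have "is_subfield {x \<in> ?L. \<tau> x \<in> ?L}"
    unfolding is_subfield_def
    by (auto simp: field_hom_simps[OF L assms(2)] intro: subfield_closed[OF L])
  then have "?L \<subseteq> {x \<in> ?L. \<tau> x \<in> ?L}"
    using hom_zeros[OF assms(2)] zeros_subset by (intro generate_field_least) auto
  with inj sup show ?thesis by (auto simp: bij_betw_def)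
qed

lemma carrier_splitting_field: "carrier (splitting_field p) = splitting_set p"
  by (simp add: splitting_field_def zeros_def)

text \<open>Field homomorphisms fix the rational numbers automatically.\<close>
lemma mem_galois_group_iff:
  "\<sigma> \<in> carrier (galois_group_of_poly p) \<longleftrightarrow>
     \<sigma> \<in> extensional (splitting_set p) \<and> bij_betw \<sigma> (splitting_set p) (splitting_set p) \<and> field_hom (splitting_set p) \<sigma>"
proof -
  let ?L = "splitting_set p"
  have ring: "\<sigma> \<in> ring_iso (splitting_field p) (splitting_field p) \<longleftrightarrow> field_hom ?L \<sigma>" if "bij_betw \<sigma> ?L ?L"
    using that bij_betw_apply[OF that]
    by (auto simp: ring_iso_def ring_hom_def carrier_splitting_field field_hom_def) (auto simp: splitting_field_def)
  have rat: "\<forall>x\<in>\<rat>. \<sigma> x = x" if "field_hom ?L \<sigma>"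
    using field_hom_of_rat[OF is_subfield_generate that] by (auto elim: Rats_cases)
  show ?thesis
    using ring rat by (auto simp: galois_group_of_poly_def galois_group_def carrier_splitting_field Bij_def)
qed

lemma galois_group_mult:
  assumes "\<sigma> \<in> carrier (galois_group_of_poly p)" "\<tau> \<in> carrier (galois_group_of_poly p)"
  shows "\<sigma> \<otimes>\<^bsub>galois_group_of_poly p\<^esub> \<tau> = compose (splitting_set p) \<sigma> \<tau>"
  using assms by (simp add: galois_group_of_poly_def galois_group_def BijGroup_def carrier_splitting_field)

lemma galois_group_one: "\<one>\<^bsub>galois_group_of_poly p\<^esub> = (\<lambda>x\<in>splitting_set p. x)"
  by (simp add: galois_group_of_poly_def galois_group_def BijGroup_def carrier_splitting_field)

lemma restrict_in_galois_group:
  assumes "p \<noteq> 0" "field_hom (splitting_set p) \<tau>"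
  shows "restrict \<tau> (splitting_set p) \<in> carrier (galois_group_of_poly p)"
proof -
  note L = is_subfield_generate[of "zeros p"]
  have "field_hom (splitting_set p) (restrict \<tau> (splitting_set p))"
    using assms(2) by (auto simp: field_hom_def subfield_closed[OF L])
  then show ?thesis using hom_splitting_bij[OF assms] unfolding mem_galois_group_iff
    by (auto simp: bij_betw_restrict_eq)
qed

lemma field_hom_compose:
  assumes "is_subfield F" "field_hom F \<tau>" "\<tau> ` F \<subseteq> F" "field_hom F \<sigma>"
  shows "field_hom F (\<lambda>x. \<sigma> (\<tau> x))"
proof -
  have "\<tau> x \<in> F" if "x \<in> F" for x using assms(3) that by blast
  then show ?thesis using assms(2,4) by (simp add: field_hom_def)
qed

lemma group_galois_group:
  assumes "p \<noteq> 0"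
  shows "group (galois_group_of_poly p)"
proof (rule groupI)
  let ?G = "galois_group_of_poly p" and ?L = "splitting_set p"
  note L = is_subfield_generate[of "zeros p"]
  have app: "\<sigma> x \<in> ?L" if "\<sigma> \<in> carrier ?G" "x \<in> ?L" for \<sigma> x
    using that bij_betw_apply unfolding mem_galois_group_iff by metis
  have closed: "compose ?L \<sigma> \<tau> \<in> carrier ?G" if "\<sigma> \<in> carrier ?G" "\<tau> \<in> carrier ?G" for \<sigma> \<tau>
    unfolding compose_def using field_hom_compose[OF L, of \<tau> \<sigma>] app that
    by (intro restrict_in_galois_group[OF assms]) (auto simp: mem_galois_group_iff)
  then show "\<sigma> \<otimes>\<^bsub>?G\<^esub> \<tau> \<in> carrier ?G" if "\<sigma> \<in> carrier ?G" "\<tau> \<in> carrier ?G" for \<sigma> \<tau>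
    using that by (simp add: galois_group_mult)
  have "field_hom ?L (\<lambda>x. x)" by (simp add: field_hom_def)
  then show one: "\<one>\<^bsub>?G\<^esub> \<in> carrier ?G"
    unfolding galois_group_one by (rule restrict_in_galois_group[OF assms])
  show "(\<sigma> \<otimes>\<^bsub>?G\<^esub> \<tau>) \<otimes>\<^bsub>?G\<^esub> \<rho> = \<sigma> \<otimes>\<^bsub>?G\<^esub> (\<tau> \<otimes>\<^bsub>?G\<^esub> \<rho>)"
    if "\<sigma> \<in> carrier ?G" "\<tau> \<in> carrier ?G" "\<rho> \<in> carrier ?G" for \<sigma> \<tau> \<rho>
    using that closed app by (auto simp: galois_group_mult compose_def fun_eq_iff)
  show "\<one>\<^bsub>?G\<^esub> \<otimes>\<^bsub>?G\<^esub> \<sigma> = \<sigma>" if "\<sigma> \<in> carrier ?G" for \<sigma>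
  proof -
    have "\<one>\<^bsub>?G\<^esub> \<otimes>\<^bsub>?G\<^esub> \<sigma> = compose ?L (\<lambda>x\<in>?L. x) \<sigma>"
      using galois_group_mult[OF one that] unfolding galois_group_one .
    also have "\<dots> = \<sigma>"
      using app[OF that] that unfolding mem_galois_group_iff by (intro extensionalityI[of _ ?L]) (auto simp: compose_def)
    finally show ?thesis .
  qed
  show "\<exists>\<tau>\<in>carrier ?G. \<tau> \<otimes>\<^bsub>?G\<^esub> \<sigma> = \<one>\<^bsub>?G\<^esub>" if \<sigma>: "\<sigma> \<in> carrier ?G" for \<sigma>
  proof -
    have bij: "bij_betw \<sigma> ?L ?L" and hom: "field_hom ?L \<sigma>" using \<sigma> by (auto simp: mem_galois_group_iff)
    define \<tau> where "\<tau> = inv_into ?L \<sigma>"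
    have inv: "\<tau> (\<sigma> x) = x" if "x \<in> ?L" for x
      using bij that unfolding \<tau>_def bij_betw_def by (simp add: inv_into_f_f)
    have "field_hom ?L \<tau>"
      unfolding field_hom_def
    proof (intro conjI ballI)
      show "\<tau> 1 = 1" using inv[OF subfield_1[OF L]] by (simp add: field_hom_1[OF L hom])
    next
      fix x y assume "x \<in> ?L" "y \<in> ?L"
      then obtain a b where ab: "x = \<sigma> a" "y = \<sigma> b" "a \<in> ?L" "b \<in> ?L"
        using bij unfolding bij_betw_def by blast
      show "\<tau> (x + y) = \<tau> x + \<tau> y"
        using ab inv[OF subfield_add[OF L ab(3,4)]] by (simp add: field_hom_add[OF L hom] inv)
      show "\<tau> (x * y) = \<tau> x * \<tau> y"
        using ab inv[OF subfield_mult[OF L ab(3,4)]] by (simp add: field_hom_mult[OF L hom] inv)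
    qed
    from restrict_in_galois_group[OF assms this]
    have r: "restrict \<tau> ?L \<in> carrier ?G" .
    have "compose ?L (restrict \<tau> ?L) \<sigma> = (\<lambda>x\<in>?L. x)"
      using app[OF \<sigma>] inv by (auto simp: compose_def fun_eq_iff)
    then show ?thesis using galois_group_mult[OF r \<sigma>] r unfolding galois_group_one by metis
  qed
qed

text \<open>The rational numbers embed in \<open>\<complex>\<close>. First \<open>a\<close> is sent to \<open>b\<close>, which is possible as \<open>p\<close> is the minimal
  polynomial of \<open>a\<close>; then the embedding is extended to the remaining zeros.\<close>
lemma galois_group_transitive:
  fixes p :: "rat poly"
  assumes monic: "Polynomial.lead_coeff p = 1"
    and min: "\<And>q. q \<noteq> 0 \<Longrightarrow> poly (map_poly of_rat q) a = 0 \<Longrightarrow> Polynomial.degree p \<le> Polynomial.degree q"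
    and ab: "a \<in> zeros p" "b \<in> zeros p"
  shows "\<exists>\<sigma>\<in>carrier (galois_group_of_poly p). \<sigma> a = b"
proof -
  let ?p = "map_poly of_rat p :: complex poly"
  have "p \<noteq> 0" using monic by auto
  have deg: "Polynomial.degree (map_poly of_rat q :: complex poly) = Polynomial.degree q" for q :: "rat poly"
    by (rule degree_map_poly) auto
  have id: "field_hom \<rat> (\<lambda>x. x)" by (simp add: field_hom_def)
  have p: "?p \<in> polys_over \<rat>" "Polynomial.lead_coeff ?p = 1" "poly ?p a = 0"
    using monic ab(1) by (auto simp: polys_over_def coeff_map_poly deg zeros_def)
  have "Polynomial.degree ?p \<le> Polynomial.degree q"
    if "q \<in> polys_over \<rat>" "poly q a = 0" "q \<noteq> 0" for q :: "complex poly"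
  proof -
    from that(1) obtain r where r: "q = map_poly of_rat r"
      using ratpolyE[of q] unfolding polys_over_def by blast
    moreover from this that(3) have "r \<noteq> 0" by auto
    ultimately show ?thesis using min[of r] that by (simp add: deg)
  qed
  note min' = this
  have b: "poly (map_poly (\<lambda>x. x) ?p) b = 0" using ab(2) by (simp add: zeros_def map_poly_idI)
  from adjoin_root[OF subfield_Rats id p min' b]
  obtain F \<tau> where F: "is_subfield F" "\<rat> \<subseteq> F" "a \<in> F" "field_hom F \<tau>" "\<tau> a = b"
    by auto
  have "?p \<in> polys_over F" using p(1) F(2) by (auto simp: polys_over_def)
  moreover have "?p \<noteq> 0" using p(2) by auto
  ultimately have "\<exists>F' \<rho>. is_subfield F' \<and> F \<subseteq> F' \<and> zeros p \<subseteq> F' \<and> field_hom F' \<rho> \<and> (\<forall>x\<in>F. \<rho> x = \<tau> x)"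
    by (rule extend_hom_finite[OF finite_zeros[OF \<open>p \<noteq> 0\<close>] F(1,4)]) (simp add: zeros_def)
  then obtain F' \<rho> where F': "is_subfield F'" "F \<subseteq> F'" "zeros p \<subseteq> F'" "field_hom F' \<rho>" "\<forall>x\<in>F. \<rho> x = \<tau> x"
    by (elim exE conjE)
  have "field_hom (splitting_set p) \<rho>"
    by (rule field_hom_subset[OF F'(4) generate_field_least[OF F'(1,3)]])
  from restrict_in_galois_group[OF \<open>p \<noteq> 0\<close> this]
  show ?thesis
  proof (rule bexI[rotated])
    have "a \<in> splitting_set p" using zeros_subset ab(1) by blast
    then show "restrict \<rho> (splitting_set p) a = b" using F(3,5) F'(5) by simp
  qed
qed

lemma cnj_in_galois_group:
  assumes "p \<noteq> 0"
  shows "restrict cnj (splitting_set p) \<in> carrier (galois_group_of_poly p)"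
  by (intro restrict_in_galois_group assms) (simp add: field_hom_def)

section \<open>Transitive groups of collineations with a transvection\<close>

text \<open>The nonzero vectors are the points of the Fano plane and the nonzero linear forms, given by \<open>dot\<close>, are its lines.\<close>
type_synonym fano = "bit^3"

definition dot :: "fano \<Rightarrow> fano \<Rightarrow> bit" where
  "dot \<phi> x = \<phi> $ 1 * x $ 1 + \<phi> $ 2 * x $ 2 + \<phi> $ 3 * x $ 3"

definition transvection :: "fano \<Rightarrow> fano \<Rightarrow> fano \<Rightarrow> fano" where
  "transvection u \<phi> x = x + dot \<phi> x *s u"

lemma fano_eq_iff: "x = y \<longleftrightarrow> x $ 1 = y $ 1 \<and> x $ 2 = y $ 2 \<and> x $ 3 = y $ 3" for x y :: fano
  by (simp add: vec_eq_iff forall_3)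

lemma bit_add_self [simp]: "(a::bit) + a = 0" "a + (a + b) = b"
  by (cases a; simp)+

lemma fano_add_self [simp]: "(x::fano) + x = 0" "x + (x + y) = y"
  by (simp_all add: fano_eq_iff)

lemma bit_scale [simp]: "0 *s x = (0::fano)" "1 *s x = (x::fano)"
  by (simp_all add: fano_eq_iff)

lemma dot_add: "dot \<phi> (x + y) = dot \<phi> x + dot \<phi> y" "dot (\<phi> + \<psi>) x = dot \<phi> x + dot \<psi> x"
  by (simp_all only: dot_def vector_add_component distrib_left distrib_right add_ac)

lemma dot_scale: "dot \<phi> (c *s x) = c * dot \<phi> x" "dot (c *s \<phi>) x = c * dot \<phi> x"
  by (simp_all only: dot_def vector_smult_component distrib_left mult_ac)

lemma dot_0 [simp]: "dot 0 x = 0" "dot \<phi> 0 = 0"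
  by (simp_all add: dot_def)

lemma dot_axis: "dot (vector [1, 0, 0]) x = x $ 1" "dot (vector [0, 1, 0]) x = x $ 2" "dot (vector [0, 0, 1]) x = x $ 3"
  "dot \<phi> (vector [1, 0, 0]) = \<phi> $ 1" "dot \<phi> (vector [0, 1, 0]) = \<phi> $ 2" "dot \<phi> (vector [0, 0, 1]) = \<phi> $ 3"
  by (simp_all add: dot_def)

lemma dot_ext: "(\<And>x. dot \<phi> x = dot \<psi> x) \<Longrightarrow> \<phi> = \<psi>"
  using dot_axis(4-6) unfolding fano_eq_iff by metis

text \<open>Over \<open>F\<^sub>2\<close> additive maps are linear.\<close>
definition additive_map :: "(fano \<Rightarrow> fano) \<Rightarrow> bool" where
  "additive_map f \<longleftrightarrow> (\<forall>x y. f (x + y) = f x + f y)"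

lemma additive_0: "additive_map f \<Longrightarrow> f 0 = 0"
  unfolding additive_map_def by (metis add_cancel_left_right)

lemma additive_scale: "additive_map f \<Longrightarrow> f (c *s x) = c *s f x"
  by (cases c) (simp_all add: additive_0)

lemma fano_basis: "x = x $ 1 *s vector [1, 0, 0] + x $ 2 *s vector [0, 1, 0] + x $ 3 *s vector [0, 0, 1]" for x :: fano
  by (simp add: fano_eq_iff)

lemma additive_eqI:
  assumes "additive_map f" "additive_map g" "f (vector [1, 0, 0]) = g (vector [1, 0, 0])"
    "f (vector [0, 1, 0]) = g (vector [0, 1, 0])" "f (vector [0, 0, 1]) = g (vector [0, 0, 1])"
  shows "f = g"
proof
  fix x
  have "h x = x $ 1 *s h (vector [1, 0, 0]) + x $ 2 *s h (vector [0, 1, 0]) + x $ 3 *s h (vector [0, 0, 1])"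
    if "additive_map h" for h
    by (subst fano_basis[of x]) (use that in \<open>simp add: additive_map_def additive_scale[OF that]\<close>)
  with assms show "f x = g x" by metis
qed

lemma functional_pullback:
  assumes "additive_map f"
  obtains \<psi> where "\<And>x. dot \<phi> (f x) = dot \<psi> x"
proof
  fix x
  let ?\<psi> = "vector [dot \<phi> (f (vector [1, 0, 0])), dot \<phi> (f (vector [0, 1, 0])), dot \<phi> (f (vector [0, 0, 1]))] :: fano"
  have f: "f x = x $ 1 *s f (vector [1, 0, 0]) + x $ 2 *s f (vector [0, 1, 0]) + x $ 3 *s f (vector [0, 0, 1])"
    by (subst fano_basis[of x]) (use assms in \<open>simp only: additive_map_def additive_scale[OF assms]\<close>)
  have "dot (vector [a, b, c]) x = x $ 1 * a + x $ 2 * b + x $ 3 * c" for a b c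
    by (simp only: dot_def vector_3 mult.commute)
  then show "dot \<phi> (f x) = dot ?\<psi> x"
    by (simp only: f dot_add dot_scale)
qed

lemma additive_transvection: "additive_map (transvection u \<phi>)"
  by (auto simp: additive_map_def transvection_def dot_add vector_sadd_rdistrib algebra_simps)

lemma transvection_invol: "dot \<phi> u = 0 \<Longrightarrow> transvection u \<phi> (transvection u \<phi> x) = x"
  by (cases "dot \<phi> x") (simp_all add: transvection_def dot_add dot_scale add.commute)

text \<open>These rules turn statements about finitely many coordinates into propositional ones.\<close>
lemma bit_propositional:
  "(a::bit) = b \<longleftrightarrow> (a = 1 \<longleftrightarrow> b = 1)"
  "(a::bit) + b = 1 \<longleftrightarrow> \<not> (a = 1 \<longleftrightarrow> b = 1)" "(a::bit) * b = 1 \<longleftrightarrow> a = 1 \<and> b = 1"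
  "(0::bit) = 1 \<longleftrightarrow> False" "(1::bit) = 1 \<longleftrightarrow> True"
  by (cases a; cases b; simp)+

lemma fano_propositional:
  "x = y \<longleftrightarrow> (x $ 1 = 1 \<longleftrightarrow> y $ 1 = 1) \<and> (x $ 2 = 1 \<longleftrightarrow> y $ 2 = 1) \<and> (x $ 3 = 1 \<longleftrightarrow> y $ 3 = 1)" for x y :: fano
  by (simp only: fano_eq_iff bit_propositional(1)[of "x $ 1" "y $ 1"] bit_propositional(1)[of "x $ 2" "y $ 2"]
      bit_propositional(1)[of "x $ 3" "y $ 3"])

lemma dot_propositional:
  "dot \<phi> x = 0 \<longleftrightarrow> (((\<phi> $ 1 = 1 \<and> x $ 1 = 1) \<longleftrightarrow> (\<phi> $ 2 = 1 \<and> x $ 2 = 1)) \<longleftrightarrow> \<not> (\<phi> $ 3 = 1 \<and> x $ 3 = 1))"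
  unfolding dot_def by (cases "\<phi> $ 1"; cases "\<phi> $ 2"; cases "\<phi> $ 3"; cases "x $ 1"; cases "x $ 2"; cases "x $ 3"; simp)

text \<open>The linear forms that vanish at \<open>u\<close> form a plane, whose nonzero elements are any two of them and their sum.\<close>
lemma annihilator_vector:
  assumes "u \<noteq> 0" "dot \<phi> u = 0" "dot \<psi> u = 0" "dot \<theta> u = 0" "\<phi> \<noteq> 0" "\<psi> \<noteq> 0" "\<theta> \<noteq> 0" "\<phi> \<noteq> \<psi>"
  shows "\<theta> = \<phi> \<or> \<theta> = \<psi> \<or> \<theta> = \<phi> + \<psi>"
  using assms unfolding fano_propositional dot_propositional vector_add_component bit_propositional(2-) zero_index
  by sat

text \<open>Two different nonzero vectors span a plane, and a plane is the kernel of just one nonzero form.\<close>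
lemma annihilator_two_vectors:
  assumes "u \<noteq> 0" "v \<noteq> 0" "u \<noteq> v" "dot \<phi> u = 0" "dot \<psi> u = 0" "dot \<phi> v = 0" "dot \<psi> v = 0" "\<phi> \<noteq> 0" "\<psi> \<noteq> 0"
  shows "\<phi> = \<psi>"
  using assms unfolding fano_propositional dot_propositional bit_propositional(2-) zero_index
  by sat

lemma ex_fano: "(\<exists>x::fano. P x) \<longleftrightarrow> (\<exists>a b c. P (vector [a, b, c]))"
proof
  assume "\<exists>x. P x"
  then obtain x where "P x" by blast
  moreover have "x = vector [x $ 1, x $ 2, x $ 3]" by (simp add: fano_eq_iff)
  ultimately show "\<exists>a b c. P (vector [a, b, c])" by metis
qed auto

lemma ex_bit: "(\<exists>x::bit. P x) \<longleftrightarrow> P 0 \<or> P 1"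
  by (metis bit_not_zero_iff)

lemma axes_meet: "\<exists>v. v \<noteq> 0 \<and> dot \<phi> v = 0 \<and> dot \<psi> v = 0"
  unfolding ex_fano ex_bit fano_eq_iff dot_def
  by (cases "\<phi> $ 1"; cases "\<phi> $ 2"; cases "\<phi> $ 3"; cases "\<psi> $ 1"; cases "\<psi> $ 2"; cases "\<psi> $ 3"; simp)

lemma ex_dot_1: "\<phi> \<noteq> 0 \<Longrightarrow> \<exists>v. dot \<phi> v = 1"
  unfolding fano_eq_iff zero_index using dot_axis(4-6)[of \<phi>] bit_not_zero_iff by metis

locale transitive_transvection_group =
  fixes H :: "(fano \<Rightarrow> fano) set"
  assumes comp: "f \<in> H \<Longrightarrow> g \<in> H \<Longrightarrow> f \<circ> g \<in> H"
    and inverse: "f \<in> H \<Longrightarrow> \<exists>g\<in>H. g \<circ> f = id"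
    and H_additive: "f \<in> H \<Longrightarrow> additive_map f"
    and transitive: "x \<noteq> 0 \<Longrightarrow> y \<noteq> 0 \<Longrightarrow> \<exists>f\<in>H. f x = y"
    and some_transvection: "\<exists>u \<phi>. u \<noteq> 0 \<and> \<phi> \<noteq> 0 \<and> dot \<phi> u = 0 \<and> transvection u \<phi> \<in> H"
begin

definition has_transvection :: "fano \<Rightarrow> fano \<Rightarrow> bool" where
  "has_transvection u \<phi> \<longleftrightarrow> u \<noteq> 0 \<and> \<phi> \<noteq> 0 \<and> dot \<phi> u = 0 \<and> transvection u \<phi> \<in> H"

lemma two_sided_inverse:
  assumes "f \<in> H"
  obtains g where "g \<in> H" "\<And>x. g (f x) = x" "\<And>x. f (g x) = x"
proof -
  obtain g where g: "g \<in> H" "g \<circ> f = id" using inverse[OF assms] by blast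
  obtain k where k: "k \<in> H" "k \<circ> g = id" using inverse[OF g(1)] by blast
  have "f x = k x" for x using fun_cong[OF g(2), of x] fun_cong[OF k(2), of "f x"] by simp
  then show ?thesis using that[of g] g k by (metis comp_apply id_apply)
qed

lemma id_in_H: "id \<in> H"
  using some_transvection inverse comp by metis

text \<open>Conjugating a transvection by \<open>f\<close> moves its centre by \<open>f\<close> and its axis along with it.\<close>
lemma conjugate:
  assumes "f \<in> H" "has_transvection u \<phi>"
  obtains \<psi> where "has_transvection (f u) \<psi>" "\<And>x. dot \<psi> (f x) = dot \<phi> x"
proof -
  obtain g where g: "g \<in> H" "\<And>x. g (f x) = x" "\<And>x. f (g x) = x" using two_sided_inverse[OF assms(1)] by metis
  obtain \<psi> where \<psi>: "\<And>x. dot \<phi> (g x) = dot \<psi> x" using functional_pullback[OF H_additive[OF g(1)], of \<phi>] by metis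
  have f: "f (x + y) = f x + f y" "f (c *s x) = c *s f x" for x y c
    using H_additive[OF assms(1)] additive_scale by (auto simp: additive_map_def)
  have eq: "f \<circ> transvection u \<phi> \<circ> g = transvection (f u) \<psi>"
    by (auto simp: fun_eq_iff transvection_def f g \<psi>)
  have "has_transvection (f u) \<psi>" unfolding has_transvection_def
  proof (intro conjI)
    show "transvection (f u) \<psi> \<in> H" unfolding eq[symmetric] using assms g by (auto simp: has_transvection_def intro!: comp)
    show "f u \<noteq> 0" using assms(2) g(2)[of u] additive_0[OF H_additive[OF g(1)]] by (auto simp: has_transvection_def)
    show "dot \<psi> (f u) = 0" using assms(2) \<psi>[of "f u"] g by (simp add: has_transvection_def)
    show "\<psi> \<noteq> 0"
    proof
      assume "\<psi> = 0"
      then have "dot \<phi> x = 0" for x using \<psi>[of "f x"] g by simp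
      then show False using ex_dot_1[of \<phi>] assms(2) by (auto simp: has_transvection_def)
    qed
  qed
  then show thesis using that[of \<psi>] \<psi> g by metis
qed

lemma every_center: "u \<noteq> 0 \<Longrightarrow> \<exists>\<phi>. has_transvection u \<phi>"
proof -
  assume "u \<noteq> 0"
  obtain v \<psi> where "has_transvection v \<psi>" using some_transvection by (auto simp: has_transvection_def)
  with transitive[of v u] \<open>u \<noteq> 0\<close> obtain f where "f \<in> H" "f v = u" by (auto simp: has_transvection_def)
  with conjugate[OF \<open>f \<in> H\<close> \<open>has_transvection v \<psi>\<close>] show ?thesis by metis
qed

text \<open>Suppose every centre \<open>u\<close> had only one axis. Conjugating the transvection at a point \<open>v\<close> of the axis of \<open>u\<close> by the
  one at \<open>u\<close> fixes \<open>v\<close>, hence by uniqueness also its axis, which therefore passes through \<open>u\<close>; so \<open>u\<close> and \<open>v\<close> have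
  the same axis. As any two axes meet, all points would have the same axis, but every point is a centre and thus
  lies on its own axis.\<close>
lemma two_axes_at_some_center: "\<exists>u \<phi> \<psi>. has_transvection u \<phi> \<and> has_transvection u \<psi> \<and> \<phi> \<noteq> \<psi>"
proof (rule ccontr)
  assume "\<not> ?thesis"
  then have uniq: "\<phi> = \<psi>" if "has_transvection u \<phi>" "has_transvection u \<psi>" for u \<phi> \<psi> using that by blast
  have same: "\<phi> = \<psi>" if "has_transvection u \<phi>" "has_transvection v \<psi>" "dot \<phi> v = 0" for u v \<phi> \<psi>
  proof (cases "u = v")
    case True
    with that uniq show ?thesis by blast
  next
    case False
    have "transvection u \<phi> \<in> H" using that(1) by (simp add: has_transvection_def)
    from conjugate[OF this that(2)] obtain \<psi>' where \<psi>': "has_transvection (transvection u \<phi> v) \<psi>'"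
      "\<And>x. dot \<psi>' (transvection u \<phi> x) = dot \<psi> x" by blast
    have "transvection u \<phi> v = v" using that(3) by (simp add: transvection_def)
    with \<psi>'(1) that(2) have "\<psi>' = \<psi>" using uniq by metis
    have "\<phi> \<noteq> 0" using that(1) by (simp add: has_transvection_def)
    then obtain x where "dot \<phi> x = 1" using ex_dot_1 by blast
    with \<psi>'(2)[of x] \<open>\<psi>' = \<psi>\<close> have "dot \<psi> x + dot \<psi> u = dot \<psi> x"
      by (simp only: transvection_def dot_add bit_scale)
    then have "dot \<psi> u = 0" by (rule add_cancel_left_right[THEN iffD1])
    then show ?thesis
      using annihilator_two_vectors[of u v \<phi> \<psi>] that False by (simp add: has_transvection_def)
  qed
  obtain u \<phi> where u: "has_transvection u \<phi>" using some_transvection by (auto simp: has_transvection_def)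
  then have "\<phi> \<noteq> 0" by (simp add: has_transvection_def)
  then obtain w where w: "dot \<phi> w = 1" using ex_dot_1 by blast
  then have "w \<noteq> 0" by (metis dot_0(2) zero_neq_one)
  then obtain \<psi> where \<psi>: "has_transvection w \<psi>" using every_center by blast
  obtain v where v: "v \<noteq> 0" "dot \<phi> v = 0" "dot \<psi> v = 0" using axes_meet by blast
  then obtain \<theta> where "has_transvection v \<theta>" using every_center by blast
  with same[OF u _ v(2)] same[OF \<psi> _ v(3)] have "\<phi> = \<psi>" by metis
  with \<psi> w show False by (simp add: has_transvection_def)
qed

text \<open>By transitivity every centre has two axes, and the product of the two transvections belongs to the third.\<close>
lemma all_transvections:
  assumes "u \<noteq> 0" "dot \<phi> u = 0"
  shows "transvection u \<phi> \<in> H"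
proof (cases "\<phi> = 0")
  case True
  then have "transvection u \<phi> = id" by (auto simp: transvection_def)
  then show ?thesis using id_in_H by simp
next
  case False
  obtain v \<psi> \<theta> where v: "has_transvection v \<psi>" "has_transvection v \<theta>" "\<psi> \<noteq> \<theta>" using two_axes_at_some_center by blast
  obtain f where f: "f \<in> H" "f v = u" using transitive[of v u] v assms by (auto simp: has_transvection_def)
  obtain \<psi>' where \<psi>': "has_transvection u \<psi>'" "\<And>x. dot \<psi>' (f x) = dot \<psi> x" using conjugate[OF f(1) v(1)] f(2) by metis
  obtain \<theta>' where \<theta>': "has_transvection u \<theta>'" "\<And>x. dot \<theta>' (f x) = dot \<theta> x" using conjugate[OF f(1) v(2)] f(2) by metis
  have "\<psi>' \<noteq> \<theta>'" using \<psi>'(2) \<theta>'(2) v(3) dot_ext by metis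
  with annihilator_vector[OF assms(1), of \<psi>' \<theta>' \<phi>] \<psi>'(1) \<theta>'(1) False assms(2)
  have "\<phi> = \<psi>' \<or> \<phi> = \<theta>' \<or> \<phi> = \<psi>' + \<theta>'" by (auto simp: has_transvection_def)
  moreover have "transvection u \<psi>' \<circ> transvection u \<theta>' = transvection u (\<psi>' + \<theta>')"
    using \<psi>'(1) by (auto simp: fun_eq_iff has_transvection_def transvection_def dot_add dot_scale vector_sadd_rdistrib algebra_simps)
  ultimately show ?thesis using \<psi>'(1) \<theta>'(1) comp[of "transvection u \<psi>'" "transvection u \<theta>'"] by (auto simp: has_transvection_def)
qed

text \<open>The transvection with centre \<open>v + w\<close> exchanges \<open>v\<close> and \<open>w\<close>.\<close>
lemma move:
  assumes "dot \<phi> v = 1" "dot \<phi> w = 1"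
  shows "\<exists>h\<in>H. h v = w \<and> (\<forall>x. dot \<phi> x = 0 \<longrightarrow> h x = x)"
proof (cases "v = w")
  case True
  then show ?thesis using id_in_H by (intro bexI[of _ id]) auto
next
  case False
  have "v + w \<noteq> 0"
  proof
    assume "v + w = 0"
    then have "v + (v + w) = v" by simp
    with False show False by simp
  qed
  moreover have "dot \<phi> (v + w) = 0" using assms by (simp add: dot_add)
  ultimately have "transvection (v + w) \<phi> \<in> H" by (rule all_transvections)
  then show ?thesis using assms by (intro bexI[of _ "transvection (v + w) \<phi>"]) (auto simp: transvection_def)
qed

text \<open>Gaussian elimination: elements of the group bring the images of the three unit vectors back one
  after the other, each step fixing the vectors that are already in place.\<close>
theorem all_additive_bijections:
  assumes "additive_map f" "inj f"
  shows "f \<in> H"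
proof -
  let ?e1 = "vector [1, 0, 0] :: fano" and ?e2 = "vector [0, 1, 0] :: fano" and ?e3 = "vector [0, 0, 1] :: fano"
  have e: "?e1 \<noteq> 0" "?e2 \<noteq> 0" "?e3 \<noteq> 0" "?e1 \<noteq> ?e2" by (simp_all add: fano_eq_iff)
  have "f ?e1 \<noteq> 0" using injD[OF assms(2), of ?e1 0] e additive_0[OF assms(1)] by auto
  with transitive e obtain h1 where h1: "h1 \<in> H" "h1 (f ?e1) = ?e1" by blast
  define v where "v = h1 (f ?e2)"
  define F1 where "F1 = h1 \<circ> f"
  have inj: "inj h" if "h \<in> H" for h using two_sided_inverse[OF that] by (metis injI)
  have inj1: "inj F1" unfolding F1_def using inj[OF h1(1)] assms(2) by (rule inj_compose)
  have add1: "additive_map F1" using assms(1) H_additive[OF h1(1)] by (simp add: F1_def additive_map_def)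
  have F1: "F1 ?e1 = ?e1" using h1 by (simp add: F1_def)
  have "F1 ?e2 \<noteq> 0" "F1 ?e2 \<noteq> ?e1"
    using injD[OF inj1, of ?e2 0] injD[OF inj1, of ?e2 ?e1] e additive_0[OF add1] F1 by auto
  then have "F1 ?e2 $ 2 = 1 \<or> F1 ?e2 $ 3 = 1"
    unfolding fano_eq_iff by (cases "F1 ?e2 $ 1") auto
  then obtain \<phi> where \<phi>: "dot \<phi> (F1 ?e2) = 1" "dot \<phi> ?e2 = 1" "dot \<phi> ?e1 = 0"
  proof (cases "F1 ?e2 $ 2 = 1")
    case True
    then show ?thesis using that[of "vector [0, 1, 0]"] by (simp add: dot_axis)
  next
    case False
    then have "F1 ?e2 $ 2 = 0" by simp
    with \<open>F1 ?e2 $ 2 = 1 \<or> F1 ?e2 $ 3 = 1\<close> show ?thesis using that[of "vector [0, 1, 1]"] by (simp add: dot_def)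
  qed
  from move[OF \<phi>(1,2)] \<phi>(3) obtain h2 where h2: "h2 \<in> H" "h2 (F1 ?e2) = ?e2" "h2 ?e1 = ?e1" by blast
  define F2 where "F2 = h2 \<circ> F1"
  have inj2: "inj F2" unfolding F2_def using inj[OF h2(1)] inj1 by (rule inj_compose)
  have add2: "additive_map F2" using add1 H_additive[OF h2(1)] by (simp add: F2_def additive_map_def)
  have F2: "F2 ?e1 = ?e1" "F2 ?e2 = ?e2" using h2 F1 by (simp_all add: F2_def)
  have "F2 ?e3 $ 3 = 1"
  proof (rule ccontr)
    assume "F2 ?e3 $ 3 \<noteq> 1"
    then have z: "F2 ?e3 $ 3 = 0" by simp
    have fixed: "F2 (a *s ?e1 + b *s ?e2) = a *s ?e1 + b *s ?e2" for a b
      using add2 by (simp only: additive_map_def additive_scale[OF add2] F2)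
    have "F2 ?e3 = F2 ?e3 $ 1 *s ?e1 + F2 ?e3 $ 2 *s ?e2"
      using z by (subst fano_basis[of "F2 ?e3"]) (simp only: bit_scale add_0_right)
    then have "?e3 = F2 ?e3 $ 1 *s ?e1 + F2 ?e3 $ 2 *s ?e2"
      using injD[OF inj2] fixed by metis
    from arg_cong[OF this, of "\<lambda>x. vec_nth x 3"] show False by simp
  qed
  then have "dot ?e3 (F2 ?e3) = 1" "dot ?e3 ?e3 = 1" "dot ?e3 ?e1 = 0" "dot ?e3 ?e2 = 0" by (simp_all add: dot_axis)
  with move[of ?e3 "F2 ?e3" ?e3] obtain h3 where h3: "h3 \<in> H" "h3 (F2 ?e3) = ?e3" "h3 ?e1 = ?e1" "h3 ?e2 = ?e2" by metis
  have "h3 \<circ> F2 = id"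
    using add2 H_additive[OF h3(1)] by (intro additive_eqI) (simp_all add: additive_map_def F2 h3)
  moreover have h: "h3 \<circ> (h2 \<circ> h1) \<in> H" using comp h1 h2 h3 by blast
  ultimately have id: "(h3 \<circ> (h2 \<circ> h1)) (f x) = x" for x
    unfolding F2_def F1_def by (metis comp_apply id_apply)
  obtain g where g: "g \<in> H" "\<And>x. g ((h3 \<circ> (h2 \<circ> h1)) x) = x" using two_sided_inverse[OF h] by metis
  have "g = f" using g(2)[of "f _"] id by (metis ext)
  with g(1) show ?thesis by simp
qed

end

section \<open>The action of the Galois group on the Fano plane\<close>

definition bit_nat :: "bit \<Rightarrow> nat" where
  "bit_nat b = (if b = 1 then 1 else 0)"

definition label :: "fano \<Rightarrow> nat" where
  "label x = bit_nat (x $ 1) + 2 * bit_nat (x $ 2) + 4 * bit_nat (x $ 3)"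

definition root_at :: "fano \<Rightarrow> complex" where
  "root_at x = septic_root (label x)"

definition dual_root_at :: "fano \<Rightarrow> complex" where
  "dual_root_at \<phi> = dual_root (label \<phi>)"

lemma label_less_8: "label x < 8"
  by (simp add: label_def bit_nat_def)

lemma label_eq_0_iff: "label x = 0 \<longleftrightarrow> x = 0"
  by (auto simp: label_def bit_nat_def fano_eq_iff)

lemma label_nonzero: "x \<noteq> 0 \<Longrightarrow> label x \<in> {1..<8}"
  using label_less_8[of x] label_eq_0_iff[of x] by auto

lemma inj_label: "inj label"
proof (rule injI)
  fix x y assume "label x = label y"
  then show "x = y" unfolding label_def fano_eq_iff
    by (cases "x $ 1"; cases "x $ 2"; cases "x $ 3"; cases "y $ 1"; cases "y $ 2"; cases "y $ 3"; simp add: bit_nat_def)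
qed

lemma finite_fano: "finite (UNIV :: fano set)"
proof (rule finite_imageD[OF _ inj_label])
  have "range label \<subseteq> {..<8}" using label_less_8 by auto
  then show "finite (range label)" by (rule finite_subset) simp
qed

lemma label_surj:
  assumes "i < 8"
  obtains x where "label x = i"
proof -
  have "i = 0 \<or> i = 1 \<or> i = 2 \<or> i = 3 \<or> i = 4 \<or> i = 5 \<or> i = 6 \<or> i = 7" using assms by auto
  then have "\<exists>x. label x = i"
    unfolding ex_fano ex_bit by (elim disjE; simp add: label_def bit_nat_def)
  then show thesis using that by blast
qed

lemma incident_label: "incident (label \<phi>) (label x) \<longleftrightarrow> dot \<phi> x = 0"
  unfolding label_def dot_def incident_def
  by (cases "x $ 1"; cases "x $ 2"; cases "x $ 3"; cases "\<phi> $ 1"; cases "\<phi> $ 2"; cases "\<phi> $ 3"; simp add: bit_nat_def)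

lemma root_at_0 [simp]: "root_at 0 = 0" and dual_root_at_0 [simp]: "dual_root_at 0 = 0"
  using label_eq_0_iff[of 0] by (simp_all add: root_at_def dual_root_at_def)

lemma inj_root_at: "inj root_at"
  using inj_onD[OF inj_septic_root] injD[OF inj_label] label_less_8
  by (auto intro!: injI simp: root_at_def)

lemma dual_septic_0: "poly dual_septic (0::complex) \<noteq> 0" "poly septic (0::complex) \<noteq> 0"
  by (simp_all add: dual_septic_def septic_def)

lemma poly_root_at: "x \<noteq> 0 \<Longrightarrow> poly septic (root_at x) = 0"
  unfolding root_at_def by (rule poly_septic_root[OF label_nonzero])

lemma poly_dual_root_at: "\<phi> \<noteq> 0 \<Longrightarrow> poly dual_septic (dual_root_at \<phi>) = 0"
  unfolding dual_root_at_def by (rule poly_dual_root[OF label_nonzero])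

lemma inj_dual_root_at: "inj dual_root_at"
proof (rule injI)
  fix \<phi> \<psi> assume eq: "dual_root_at \<phi> = dual_root_at \<psi>"
  then have "\<phi> = 0 \<longleftrightarrow> \<psi> = 0" using poly_dual_root_at[of \<phi>] poly_dual_root_at[of \<psi>] dual_septic_0 dual_root_at_0 by metis
  then show "\<phi> = \<psi>"
    using inj_onD[OF inj_dual_root _ label_nonzero label_nonzero, of \<phi> \<psi>] eq injD[OF inj_label]
    unfolding dual_root_at_def by blast
qed

lemma septic_zero_labelled:
  assumes "poly septic (z::complex) = 0"
  obtains x where "x \<noteq> 0" "z = root_at x"
proof -
  obtain i where i: "i \<in> {1..<8}" "z = septic_root i" using assms septic_zeros by blast
  obtain x where "label x = i" using label_surj[of i] i by auto
  with i that[of x] label_eq_0_iff[of x] show thesis by (auto simp: root_at_def)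
qed

lemma dual_septic_zero_labelled:
  assumes "poly dual_septic (z::complex) = 0"
  obtains \<phi> where "\<phi> \<noteq> 0" "z = dual_root_at \<phi>"
proof -
  obtain i where i: "i \<in> {1..<8}" "z = dual_root i" using assms dual_septic_zeros by blast
  obtain x where "label x = i" using label_surj[of i] i by auto
  with i that[of x] label_eq_0_iff[of x] show thesis by (auto simp: dual_root_at_def)
qed

lemma incidence_at_iff:
  assumes "\<phi> \<noteq> 0" "x \<noteq> 0"
  shows "poly (cubic (dual_root_at \<phi>)) (root_at x) = 0 \<longleftrightarrow> dot \<phi> x = 0"
  unfolding root_at_def dual_root_at_def
  using incident_iff[OF label_nonzero[OF assms(1)] label_nonzero[OF assms(2)]] incident_label by simp

lemma map_poly_septic: "map_poly of_rat (septic :: rat poly) = (septic :: complex poly)"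
  by (simp add: septic_def map_poly_pCons)

lemma map_poly_dual_septic: "map_poly of_rat (dual_septic :: rat poly) = (dual_septic :: complex poly)"
  by (simp add: dual_septic_def map_poly_pCons)

abbreviation septic_field :: "complex set" where "septic_field \<equiv> splitting_set septic"
abbreviation septic_galois :: "(complex \<Rightarrow> complex) monoid" where "septic_galois \<equiv> galois_group_of_poly septic"

lemma zeros_septic: "z \<in> zeros septic \<longleftrightarrow> poly septic z = 0"
  by (simp add: zeros_def map_poly_septic)

lemma septic_nonzero: "(septic :: rat poly) \<noteq> 0"
  by (simp add: septic_def)

lemma septic_field_subfield: "is_subfield septic_field"
  by (rule is_subfield_generate)

lemma root_at_in_field: "root_at x \<in> septic_field"
proof (cases "x = 0")
  case True
  then show ?thesis using subfield_0[OF septic_field_subfield] by simp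
next
  case False
  then show ?thesis using poly_root_at zeros_septic zeros_subset by blast
qed

text \<open>The cubic is a product of linear factors over the splitting field, and \<open>2 v\<close> is a difference of two of its
  coefficients, up to the constant 2.\<close>
lemma dual_root_at_in_field: "dual_root_at \<phi> \<in> septic_field"
proof (cases "\<phi> = 0")
  case True
  then show ?thesis using subfield_0[OF septic_field_subfield] by simp
next
  case False
  let ?v = "dual_root_at \<phi>"
  have lead: "Polynomial.lead_coeff (cubic ?v) = 1" by (simp add: cubic_def)
  have "poly septic z = 0" if "poly (cubic ?v) z = 0" for z
    unfolding septic_factorization[OF poly_dual_root_at[OF False]] using that by simp
  from septic_divisor_split[OF lead this]
  obtain ns where ns: "cubic ?v = (\<Prod>i\<leftarrow>ns. [:-septic_root i, 1:])" "set ns \<subseteq> {1..<8}" by metis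
  have "(\<Prod>i\<leftarrow>ns. [:-septic_root i, 1:]) \<in> polys_over septic_field"
    using ns(2)
  proof (induction ns)
    case Nil
    have "pCons 1 0 \<in> polys_over septic_field"
      by (intro polys_over_closed[OF septic_field_subfield] subfield_1[OF septic_field_subfield])
    then show ?case by (simp add: one_pCons)
  next
    case (Cons i ns)
    then have "septic_root i \<in> septic_field" using poly_septic_root[of i] zeros_septic zeros_subset by force
    then have "[:-septic_root i, 1:] \<in> polys_over septic_field"
      by (intro polys_over_closed[OF septic_field_subfield] subfield_closed[OF septic_field_subfield])
    moreover have "(\<Prod>i\<leftarrow>ns. [:-septic_root i, 1:]) \<in> polys_over septic_field" using Cons by simp
    ultimately show ?case unfolding list.map prod_list.Cons by (rule polys_over_closed(4)[OF septic_field_subfield])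
  qed
  then have c: "Polynomial.coeff (cubic ?v) i \<in> septic_field" for i unfolding ns(1) by (simp add: polys_over_def)
  have "?v = (Polynomial.coeff (cubic ?v) 0 - Polynomial.coeff (cubic ?v) 2 + of_int 2) * inverse (of_int 2)"
    by (simp add: cubic_def eval_nat_numeral algebra_simps)
  also have "\<dots> \<in> septic_field"
    by (intro subfield_closed[OF septic_field_subfield] subfield_of_int[OF septic_field_subfield] c)
  finally show ?thesis .
qed

lemma hom_int_poly:
  assumes "field_hom septic_field \<tau>" "z \<in> septic_field"
  shows "\<tau> (poly (map_poly of_int p) z) = poly (map_poly of_int p) (\<tau> z)"
proof -
  have "map_poly of_int p = (map_poly of_rat (map_poly of_int p) :: complex poly)"
    by (intro poly_eqI) (simp add: coeff_map_poly)
  then show ?thesis using hom_rat_poly[OF septic_field_subfield assms] by metis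
qed

lemma hom_cubic:
  assumes "field_hom septic_field \<tau>" "v \<in> septic_field"
  shows "cubic v \<in> polys_over septic_field" "map_poly \<tau> (cubic v) = cubic (\<tau> v)"
proof -
  define c0 c1 c2 :: "int poly" where "c0 = [:0, 0, -1:]" and "c1 = [:0, 0, -8, -6, 3, 4, 1:]" and "c2 = [:2, -2, -1:]"
  have cubic: "cubic w = [:poly (map_poly of_int c0) w, poly (map_poly of_int c1) w, poly (map_poly of_int c2) w, 1:]"
    for w :: complex by (simp add: cubic_def c0_def c1_def c2_def map_poly_pCons)
  have "poly (map_poly of_int c) v \<in> septic_field" for c :: "int poly"
    by (intro poly_in_subfield[OF septic_field_subfield _ assms(2)])
       (simp add: polys_over_def coeff_map_poly subfield_of_int[OF septic_field_subfield])
  then show "cubic v \<in> polys_over septic_field" unfolding cubic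
    by (intro polys_over_closed[OF septic_field_subfield] subfield_1[OF septic_field_subfield])
  show "map_poly \<tau> (cubic v) = cubic (\<tau> v)"
    unfolding cubic by (simp add: map_poly_pCons hom_int_poly[OF assms] field_hom_0[OF septic_field_subfield assms(1)] field_hom_1[OF septic_field_subfield assms(1)])
qed

text \<open>The permutation of the labels induced by an automorphism.\<close>
definition moves :: "(complex \<Rightarrow> complex) \<Rightarrow> (fano \<Rightarrow> fano) \<Rightarrow> bool" where
  "moves \<sigma> f \<longleftrightarrow> (\<forall>x. \<sigma> (root_at x) = root_at (f x))"

text \<open>An automorphism permutes roots and companion roots and maps the cubic of \<open>v\<close> to the cubic of the image of \<open>v\<close>. The two
  permutations therefore preserve the pairing \<open>dot\<close>. Since the one of the linear forms is onto, the
  one of the vectors is additive.\<close>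
lemma galois_action:
  assumes \<tau>: "field_hom septic_field \<tau>"
  obtains f where "moves \<tau> f" "additive_map f" "inj f"
proof -
  note hom0 = field_hom_0[OF septic_field_subfield \<tau>]
  \<comment> \<open>The permutation \<open>f\<close> of the points and the permutation \<open>g\<close> of the lines.\<close>
  have injL: "inj_on \<tau> septic_field" by (rule field_hom_inj_on[OF septic_field_subfield \<tau>])
  have "\<exists>y. \<tau> (root_at x) = root_at y" for x
  proof (cases "x = 0")
    case True
    then show ?thesis using hom0 by (intro exI[of _ 0]) simp
  next
    case False
    have "\<tau> (poly septic (root_at x)) = poly septic (\<tau> (root_at x))"
      using hom_rat_poly[OF septic_field_subfield \<tau> root_at_in_field, of septic x] by (simp add: map_poly_septic)
    then have "poly septic (\<tau> (root_at x)) = 0" using poly_root_at[OF False] hom0 by simp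
    then show ?thesis using septic_zero_labelled by metis
  qed
  then obtain f where f: "\<And>x. \<tau> (root_at x) = root_at (f x)" by metis
  have "\<exists>\<psi>. \<tau> (dual_root_at \<phi>) = dual_root_at \<psi>" for \<phi>
  proof (cases "\<phi> = 0")
    case True
    then show ?thesis using hom0 by (intro exI[of _ 0]) simp
  next
    case False
    have "\<tau> (poly dual_septic (dual_root_at \<phi>)) = poly dual_septic (\<tau> (dual_root_at \<phi>))"
      using hom_rat_poly[OF septic_field_subfield \<tau> dual_root_at_in_field, of dual_septic \<phi>] by (simp add: map_poly_dual_septic)
    then have "poly dual_septic (\<tau> (dual_root_at \<phi>)) = 0" using poly_dual_root_at[OF False] hom0 by simp
    then show ?thesis using dual_septic_zero_labelled by metis
  qed
  then obtain g where g: "\<And>\<phi>. \<tau> (dual_root_at \<phi>) = dual_root_at (g \<phi>)" by metis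
  have "inj f"
    using f inj_onD[OF injL _ root_at_in_field root_at_in_field] injD[OF inj_root_at] by (metis injI)
  have "inj g"
    using g inj_onD[OF injL _ dual_root_at_in_field dual_root_at_in_field] injD[OF inj_dual_root_at] by (metis injI)
  then have "surj g" by (rule finite_UNIV_inj_surj[OF finite_fano])
  have f0: "f 0 = 0" using f[of 0] hom0 injD[OF inj_root_at, of "f 0" 0] by simp
  have g0: "g 0 = 0" using g[of 0] hom0 injD[OF inj_dual_root_at, of "g 0" 0] by simp
  have dot: "dot (g \<phi>) (f x) = dot \<phi> x" for \<phi> x
  proof (cases "\<phi> = 0 \<or> x = 0")
    case True
    then show ?thesis using f0 g0 by auto
  next
    case False
    then have "f x \<noteq> 0" "g \<phi> \<noteq> 0" using injD[OF \<open>inj f\<close>] injD[OF \<open>inj g\<close>] f0 g0 by metis+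
    note cub = hom_cubic[OF \<tau> dual_root_at_in_field[of \<phi>]]
    have "dot (g \<phi>) (f x) = 0 \<longleftrightarrow> poly (cubic (\<tau> (dual_root_at \<phi>))) (\<tau> (root_at x)) = 0"
      using incidence_at_iff[OF \<open>g \<phi> \<noteq> 0\<close> \<open>f x \<noteq> 0\<close>] f g by simp
    also have "\<dots> \<longleftrightarrow> \<tau> (poly (cubic (dual_root_at \<phi>)) (root_at x)) = 0"
      using field_hom_poly[OF septic_field_subfield \<tau> cub(1) root_at_in_field[of x]] cub(2) by simp
    also have "\<dots> \<longleftrightarrow> poly (cubic (dual_root_at \<phi>)) (root_at x) = 0"
      by (rule field_hom_eq_0_iff[OF septic_field_subfield \<tau> poly_in_subfield[OF septic_field_subfield cub(1) root_at_in_field]])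
    also have "\<dots> \<longleftrightarrow> dot \<phi> x = 0" using incidence_at_iff False by blast
    finally show ?thesis by (metis bit_not_zero_iff)
  qed
  have "additive_map f"
    unfolding additive_map_def
  proof (intro allI)
    fix x y
    have *: "dot \<psi> (f (x + y)) = dot \<psi> (f x + f y)" for \<psi>
    proof -
      obtain \<phi> where "\<psi> = g \<phi>" using \<open>surj g\<close> by blast
      then show ?thesis by (simp only: dot dot_add)
    qed
    show "f (x + y) = f x + f y"
      unfolding fano_eq_iff using *[of "vector [1, 0, 0]"] *[of "vector [0, 1, 0]"] *[of "vector [0, 0, 1]"]
      by (simp only: dot_axis)
  qed
  then show thesis using that[of f] f \<open>inj f\<close> by (simp add: moves_def)
qed

lemma moves_unique: "moves \<sigma> f \<Longrightarrow> moves \<sigma> g \<Longrightarrow> f = g"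
  using injD[OF inj_root_at] by (auto simp: moves_def)

text \<open>The elements where two automorphisms agree form a subfield.\<close>
lemma moves_inj:
  assumes "\<sigma> \<in> carrier septic_galois" "\<tau> \<in> carrier septic_galois" "moves \<sigma> f" "moves \<tau> f"
  shows "\<sigma> = \<tau>"
proof -
  have hom: "field_hom septic_field \<sigma>" "field_hom septic_field \<tau>" and ext: "\<sigma> \<in> extensional septic_field" "\<tau> \<in> extensional septic_field"
    using assms(1,2) by (auto simp: mem_galois_group_iff)
  have "is_subfield {x \<in> septic_field. \<sigma> x = \<tau> x}"
    unfolding is_subfield_def
    by (auto simp: field_hom_simps[OF septic_field_subfield hom(1)] field_hom_simps[OF septic_field_subfield hom(2)] intro: subfield_closed[OF septic_field_subfield])
  moreover have "zeros septic \<subseteq> {x \<in> septic_field. \<sigma> x = \<tau> x}"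
  proof
    fix z assume "z \<in> zeros septic"
    then obtain x where "z = root_at x" using septic_zero_labelled zeros_septic by metis
    then show "z \<in> {x \<in> septic_field. \<sigma> x = \<tau> x}" using assms(3,4) root_at_in_field by (auto simp: moves_def)
  qed
  ultimately have "septic_field \<subseteq> {x \<in> septic_field. \<sigma> x = \<tau> x}" by (rule generate_field_least)
  then show ?thesis using ext by (intro extensionalityI[of _ septic_field]) auto
qed

lemma moves_mult:
  assumes "\<sigma> \<in> carrier septic_galois" "\<tau> \<in> carrier septic_galois" "moves \<sigma> f" "moves \<tau> g"
  shows "moves (\<sigma> \<otimes>\<^bsub>septic_galois\<^esub> \<tau>) (f \<circ> g)"
  using assms(3,4) root_at_in_field by (simp add: galois_group_mult[OF assms(1,2)] moves_def compose_def)

lemma moves_one: "moves \<one>\<^bsub>septic_galois\<^esub> id"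
  using root_at_in_field by (simp add: galois_group_one moves_def)

text \<open>With the chosen numbering complex conjugation is a transvection with axis the line of real roots.\<close>
lemma conj_index_label: "conj_index (label x) = label (transvection (vector [1, 0, 0]) (vector [0, 0, 1]) x)"
  unfolding label_def transvection_def dot_axis conj_index_def
  by (cases "x $ 1"; cases "x $ 2"; cases "x $ 3"; simp add: bit_nat_def)

interpretation G: group septic_galois
  by (rule group_galois_group[OF septic_nonzero])

interpretation T: transitive_transvection_group "{f. \<exists>\<sigma>\<in>carrier septic_galois. moves \<sigma> f}"
proof (unfold_locales, goal_cases)
  case (1 f g)
  then show ?case using moves_mult G.m_closed by blast
next
  case (2 f)
  then obtain \<sigma> where \<sigma>: "\<sigma> \<in> carrier septic_galois" "moves \<sigma> f" by blast
  then have inv: "inv\<^bsub>septic_galois\<^esub> \<sigma> \<in> carrier septic_galois" "inv\<^bsub>septic_galois\<^esub> \<sigma> \<otimes>\<^bsub>septic_galois\<^esub> \<sigma> = \<one>\<^bsub>septic_galois\<^esub>" by (simp_all)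
  then obtain g where g: "moves (inv\<^bsub>septic_galois\<^esub> \<sigma>) g" using galois_action mem_galois_group_iff by metis
  have "g \<circ> f = id"
    using moves_unique[OF moves_mult[OF inv(1) \<sigma>(1) g \<sigma>(2)]] moves_one unfolding inv(2) by blast
  with g inv(1) show ?case by blast
next
  case (3 f)
  then obtain \<sigma> where "field_hom septic_field \<sigma>" "moves \<sigma> f" by (auto simp: mem_galois_group_iff)
  with galois_action moves_unique show ?case by metis
next
  \<comment> \<open>The group is transitive because the septic is the minimal polynomial of each of its roots.\<close>
  case (4 x y)
  have deg: "Polynomial.degree (septic :: rat poly) \<le> Polynomial.degree q" if "q \<noteq> 0" "poly (map_poly of_rat q) (root_at x) = 0" for q
    using rat_poly_root_degree[OF that poly_root_at[OF 4(1)]] by simp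
  have "Polynomial.lead_coeff (septic :: rat poly) = 1" by simp
  from galois_group_transitive[of septic "root_at x" "root_at y", OF this deg] poly_root_at 4
  obtain \<sigma> where \<sigma>: "\<sigma> \<in> carrier septic_galois" "\<sigma> (root_at x) = root_at y" by (auto simp: zeros_septic)
  then obtain f where f: "moves \<sigma> f" using galois_action mem_galois_group_iff by metis
  then have "f x = y" using \<sigma>(2) injD[OF inj_root_at] by (auto simp: moves_def)
  with \<sigma>(1) f show ?case by blast
next
  \<comment> \<open>Complex conjugation acts as a transvection.\<close>
  case 5
  let ?u = "vector [1, 0, 0] :: fano" and ?\<phi> = "vector [0, 0, 1] :: fano"
  have "moves (restrict cnj septic_field) (transvection ?u ?\<phi>)"
    unfolding moves_def
  proof
    fix x
    show "restrict cnj septic_field (root_at x) = root_at (transvection ?u ?\<phi> x)"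
      using root_at_in_field[of x] cnj_septic_root[OF label_less_8] by (simp add: root_at_def conj_index_label)
  qed
  moreover have "?u \<noteq> 0" "?\<phi> \<noteq> 0" "dot ?\<phi> ?u = 0" by (simp_all add: fano_eq_iff dot_axis)
  ultimately show ?case using cnj_in_galois_group[OF septic_nonzero] by blast
qed

section \<open>Identification with the projective special linear group\<close>

lemma group_SL: "group (SL :: ('a::field^'n^'n) monoid)"
proof (rule groupI)
  show "\<exists>B\<in>carrier SL. B \<otimes>\<^bsub>SL\<^esub> A = \<one>\<^bsub>SL\<^esub>" if "A \<in> carrier SL" for A :: "'a^'n^'n"
  proof -
    have "det A = 1" using that by (simp add: SL_def)
    then have "invertible A" by (simp add: invertible_det_nz)
    then obtain B where B: "B ** A = mat 1" by (auto simp: invertible_def)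
    then have "det B * det A = 1" by (metis det_mul det_I)
    with \<open>det A = 1\<close> B show ?thesis by (intro bexI[of _ B]) (simp_all add: SL_def)
  qed
qed (auto simp: SL_def det_mul matrix_mul_assoc)

lemma additive_linear:
  assumes "additive_map f"
  shows "Vector_Spaces.linear (*s) (*s) f"
proof -
  have "f (x + y) = f x + f y" "f (c *s x) = c *s f x" for x y c
    using assms additive_scale[OF assms] by (simp_all add: additive_map_def)
  then show ?thesis
    by (simp add: Vector_Spaces.linear_iff vec.vector_space_axioms)
qed

lemma matrix_additive:
  assumes "additive_map f"
  shows "matrix f *v x = f x"
  by (rule matrix_works[OF additive_linear[OF assms]])

lemma additive_matrix_vector: "additive_map ((*v) A)"
  by (simp add: additive_map_def matrix_vector_right_distrib)

lemma SL_iff_inj: "A \<in> carrier (SL :: (fano^3) monoid) \<longleftrightarrow> inj ((*v) A)"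
proof -
  have "A \<in> carrier SL \<longleftrightarrow> invertible A" by (simp add: SL_def invertible_det_nz)
  also have "\<dots> \<longleftrightarrow> inj ((*v) A)"
    by (simp add: invertible_left_inverse matrix_left_invertible_injective)
  finally show ?thesis .
qed

lemma matrix_additive_SL:
  assumes "additive_map f" "inj f"
  shows "matrix f \<in> carrier SL"
proof -
  have "(*v) (matrix f) = f" using matrix_additive[OF assms(1)] by auto
  then show ?thesis using assms(2) by (simp add: SL_iff_inj)
qed

text \<open>A matrix that commutes with a transvection maps the centre of the transvection to a multiple of it, and 1 is
  the only nonzero scalar. Every nonzero vector is a centre.\<close>
lemma center_SL: "group_center (SL :: (fano^3) monoid) = {mat 1}"
proof (intro equalityI subsetI)
  fix A :: "fano^3" assume "A \<in> {mat 1}"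
  then show "A \<in> group_center SL" by (simp add: group_center_def SL_def)
next
  fix A :: "fano^3" assume A: "A \<in> group_center SL"
  have SL: "A \<in> carrier SL" using A by (simp add: group_center_def)
  have "A *v u = u" for u
  proof (cases "u = 0")
    case True
    then show ?thesis by simp
  next
    case False
    obtain \<phi> where \<phi>: "\<phi> \<noteq> 0" "dot \<phi> u = 0"
      using axes_meet[of u u] by (auto simp: dot_def mult.commute)
    let ?f = "transvection u \<phi>"
    have inv: "?f (?f x) = x" for x using transvection_invol[OF \<phi>(2)] .
    then have "inj ?f" by (metis injI)
    from matrix_additive_SL[OF additive_transvection this]
    have "A ** matrix ?f = matrix ?f ** A" using A by (simp add: group_center_def SL_def)
    then have comm: "A *v (?f x) = ?f (A *v x)" for x
      by (metis additive_transvection matrix_additive matrix_vector_mul_assoc)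
    obtain x where x: "dot \<phi> x = 1" using ex_dot_1[OF \<phi>(1)] by blast
    have "A *v (x + u) = A *v x + dot \<phi> (A *v x) *s u"
      using comm[of x] by (simp only: transvection_def x bit_scale)
    then have "A *v u = dot \<phi> (A *v x) *s u" by (simp add: matrix_vector_right_distrib)
    moreover have "A *v u \<noteq> 0"
      using SL False injD[of "(*v) A" u 0] by (auto simp: SL_iff_inj)
    ultimately show ?thesis by (cases "dot \<phi> (A *v x)") simp_all
  qed
  then show "A \<in> {mat 1}" by (simp add: matrix_eq)
qed

definition galois_of_matrix :: "fano^3 \<Rightarrow> complex \<Rightarrow> complex" where
  "galois_of_matrix A = (SOME \<sigma>. \<sigma> \<in> carrier septic_galois \<and> moves \<sigma> ((*v) A))"

lemma galois_of_matrix: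
  assumes "A \<in> carrier SL"
  shows "galois_of_matrix A \<in> carrier septic_galois" "moves (galois_of_matrix A) ((*v) A)"
proof -
  have "\<exists>\<sigma>. \<sigma> \<in> carrier septic_galois \<and> moves \<sigma> ((*v) A)"
    using T.all_additive_bijections[OF additive_matrix_vector] assms by (auto simp: SL_iff_inj)
  from someI_ex[OF this] show "galois_of_matrix A \<in> carrier septic_galois" "moves (galois_of_matrix A) ((*v) A)"
    by (simp_all add: galois_of_matrix_def)
qed

text \<open>Sending a matrix to the automorphism that moves the roots accordingly is an isomorphism from \<open>SL\<close>. Because its kernel is
  trivial, like the centre, the homomorphism theorem yields the claim for the quotient.\<close>
theorem galois_group_septic: "galois_group_of_poly septic \<cong> (PSL :: (bit^3^3) set monoid)"
proof -
  interpret S: group "SL :: (fano^3) monoid" by (rule group_SL)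
  interpret h: group_hom "SL :: (fano^3) monoid" septic_galois galois_of_matrix
  proof (unfold_locales, rule homI)
    fix A B :: "fano^3" assume AB: "A \<in> carrier SL" "B \<in> carrier SL"
    show "galois_of_matrix A \<in> carrier septic_galois" by (rule galois_of_matrix(1)[OF AB(1)])
    have "A \<otimes>\<^bsub>SL\<^esub> B \<in> carrier SL" using AB by simp
    note AB' = galois_of_matrix[OF this]
    have "moves (galois_of_matrix A \<otimes>\<^bsub>septic_galois\<^esub> galois_of_matrix B) ((*v) A \<circ> (*v) B)"
      by (intro moves_mult galois_of_matrix AB)
    also have "(*v) A \<circ> (*v) B = (*v) (A \<otimes>\<^bsub>SL\<^esub> B)"
      by (simp add: fun_eq_iff SL_def matrix_vector_mul_assoc)
    finally show "galois_of_matrix (A \<otimes>\<^bsub>SL\<^esub> B) = galois_of_matrix A \<otimes>\<^bsub>septic_galois\<^esub> galois_of_matrix B"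
      using moves_inj[OF AB'(1) _ AB'(2)] galois_of_matrix(1)[OF AB(1)] galois_of_matrix(1)[OF AB(2)] G.m_closed by blast
  qed
  have onto: "galois_of_matrix ` carrier SL = carrier septic_galois"
  proof (intro equalityI subsetI)
    fix \<sigma> assume \<sigma>: "\<sigma> \<in> carrier septic_galois"
    then obtain f where f: "moves \<sigma> f" "additive_map f" "inj f"
      using galois_action mem_galois_group_iff by metis
    have M: "matrix f \<in> carrier SL" by (rule matrix_additive_SL[OF f(2,3)])
    have "(*v) (matrix f) = f" using matrix_additive[OF f(2)] by auto
    with galois_of_matrix[OF M] f(1) \<sigma> have "galois_of_matrix (matrix f) = \<sigma>" using moves_inj by metis
    with M show "\<sigma> \<in> galois_of_matrix ` carrier SL" by blast
  qed (use galois_of_matrix(1) in auto)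
  have "kernel SL septic_galois galois_of_matrix = {mat 1}"
  proof (intro equalityI subsetI)
    fix A assume "A \<in> kernel SL septic_galois galois_of_matrix"
    then have A: "A \<in> carrier SL" "galois_of_matrix A = \<one>\<^bsub>septic_galois\<^esub>" by (auto simp: kernel_def)
    then have "(*v) A = id" using moves_unique[OF _ moves_one] galois_of_matrix(2)[OF A(1)] by metis
    then show "A \<in> {mat 1}" by (simp add: matrix_eq fun_eq_iff)
  next
    fix A :: "fano^3" assume "A \<in> {mat 1}"
    then have "A = \<one>\<^bsub>SL\<^esub>" by (simp add: SL_def)
    then show "A \<in> kernel SL septic_galois galois_of_matrix" by (simp add: kernel_def)
  qed
  with h.FactGroup_iso[OF onto] have "(PSL :: (bit^3^3) set monoid) \<cong> septic_galois"
    by (simp add: PSL_def center_SL)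
  moreover have "group (PSL :: (bit^3^3) set monoid)"
  proof -
    have "(SL :: (fano^3) monoid) Mod kernel SL septic_galois galois_of_matrix = PSL"
      using \<open>kernel SL septic_galois galois_of_matrix = {mat 1}\<close> by (simp add: PSL_def center_SL)
    with normal.factorgroup_is_group[OF h.normal_kernel] show ?thesis by simp
  qed
  ultimately show ?thesis by (rule group.iso_sym[rotated])
qed

section \<open>Reflections and folds in the plane\<close>

lemma closest_point_hyperplane:
  fixes n A :: "'a::euclidean_space"
  assumes "n \<noteq> 0"
  shows "closest_point {x. n \<bullet> x = c} A = A - ((n \<bullet> A - c) / (n \<bullet> n)) *\<^sub>R n"
proof (rule closest_point_unique[symmetric])
  let ?k = "(n \<bullet> A - c) / (n \<bullet> n)"
  have nn: "n \<bullet> n \<noteq> 0" using assms by simp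
  show "A - ?k *\<^sub>R n \<in> {x. n \<bullet> x = c}" using nn by (simp add: inner_diff_right)
  show "\<forall>z\<in>{x. n \<bullet> x = c}. dist A (A - ?k *\<^sub>R n) \<le> dist A z"
  proof
    fix z assume "z \<in> {x. n \<bullet> x = c}"
    then have "\<bar>n \<bullet> A - c\<bar> = \<bar>n \<bullet> (A - z)\<bar>" by (simp add: inner_diff_right)
    also have "\<dots> \<le> norm n * dist A z" by (simp add: dist_norm Cauchy_Schwarz_ineq2)
    finally have "\<bar>n \<bullet> A - c\<bar> \<le> norm n * dist A z" .
    moreover have "dist A (A - ?k *\<^sub>R n) = \<bar>n \<bullet> A - c\<bar> / norm n"
      using assms by (simp add: dist_norm abs_mult power2_norm_eq_inner[symmetric] power2_eq_square)
    ultimately show "dist A (A - ?k *\<^sub>R n) \<le> dist A z" using assms by (simp add: divide_le_eq mult.commute)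
  qed
qed (auto simp: convex_hyperplane closed_hyperplane)

lemma inner_plane: "(x::real^2) \<bullet> y = x $ 1 * y $ 1 + x $ 2 * y $ 2"
  by (simp add: inner_vec_def sum_2)

lemma plane_eq_iff: "(x::real^2) = y \<longleftrightarrow> x $ 1 = y $ 1 \<and> x $ 2 = y $ 2"
  by (simp add: vec_eq_iff forall_2)

lemma is_line_iff: "is_line l \<longleftrightarrow> (\<exists>n c. n \<noteq> 0 \<and> l = {A. n \<bullet> A = c})"
proof -
  have "aff_dim l = 1 \<longleftrightarrow> (\<exists>n c. n \<noteq> 0 \<and> affine hull l = {A. n \<bullet> A = c})"
    using aff_dim_eq_hyperplane[of l] by simp
  then show ?thesis unfolding is_line_def by (metis affine_hull_eq affine_hyperplane)
qed

lemma reflection_hyperplane: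
  fixes n :: "real^2"
  assumes "n \<noteq> 0"
  shows "reflection {A. n \<bullet> A = c} A = A - (2 * (n \<bullet> A - c) / (n \<bullet> n)) *\<^sub>R n"
  unfolding reflection_def closest_point_hyperplane[OF assms]
  by (simp add: scaleR_2 algebra_simps)

text \<open>A reflection is determined by the displacement \<open>D\<close> of one point \<open>A\<close> off its axis, since \<open>D\<close> is a normal
  vector. This gives the image of any other point without mention of the line.\<close>
lemma reflection_from_image:
  fixes n :: "real^2"
  assumes "n \<noteq> 0" and D: "D = reflection {A. n \<bullet> A = c} A - A" "D \<noteq> 0"
  shows "reflection {A. n \<bullet> A = c} B = B + D - (2 * (D \<bullet> (B - A)) / (D \<bullet> D)) *\<^sub>R D"
proof -
  define t where "t = - (2 * (n \<bullet> A - c) / (n \<bullet> n))"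
  have nn: "n \<bullet> n \<noteq> 0" using assms(1) by simp
  have Dt: "D = t *\<^sub>R n" unfolding D reflection_hyperplane[OF assms(1)] t_def by simp
  with D(2) have "t \<noteq> 0" by auto
  have "n \<bullet> A - c = - t * (n \<bullet> n) / 2" using nn by (simp add: t_def)
  then have k: "2 * (n \<bullet> B - c) / (n \<bullet> n) = 2 * (n \<bullet> (B - A)) / (n \<bullet> n) - t"
    using nn by (simp add: inner_diff_right field_simps)
  have kD: "(2 * (D \<bullet> (B - A)) / (D \<bullet> D)) *\<^sub>R D = (2 * (n \<bullet> (B - A)) / (n \<bullet> n)) *\<^sub>R n"
    unfolding Dt using \<open>t \<noteq> 0\<close> nn by simp
  show ?thesis
    unfolding reflection_hyperplane[OF assms(1)] k kD unfolding Dt by (simp add: scaleR_left_diff_distrib)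
qed

definition bisector :: "real^2 \<Rightarrow> real^2 \<Rightarrow> (real^2) set" where
  "bisector A B = {x. (B - A) \<bullet> x = (B - A) \<bullet> A + (B - A) \<bullet> (B - A) / 2}"

lemma is_line_bisector: "A \<noteq> B \<Longrightarrow> is_line (bisector A B)"
  unfolding is_line_iff bisector_def by (intro exI[of _ "B - A"]) auto

lemma reflection_bisector: "A \<noteq> B \<Longrightarrow> reflection (bisector A B) A = B"
  unfolding bisector_def by (subst reflection_hyperplane) auto

text \<open>The lines that reflect the origin into \<open>y = -2\<close>, by slope.\<close>
definition fold_line :: "real \<Rightarrow> (real^2) set" where
  "fold_line s = {A. A $ 2 = s * A $ 1 - (s^2 + 1)}"

lemma fold_line_hyperplane: "fold_line s = {A. vector [s, -1] \<bullet> A = s^2 + 1}"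
  by (auto simp: fold_line_def inner_plane)

lemma is_line_fold_line: "is_line (fold_line s)"
  unfolding is_line_iff fold_line_hyperplane by (intro exI[of _ "vector [s, -1]"]) (auto simp: plane_eq_iff)

lemma reflection_fold_line:
  "reflection (fold_line s) A = A - (2 * (s * A $ 1 - A $ 2 - (s^2 + 1)) / (s^2 + 1)) *\<^sub>R vector [s, -1]"
  unfolding fold_line_hyperplane
  by (subst reflection_hyperplane) (auto simp: plane_eq_iff inner_plane power2_eq_square)

text \<open>The displacement of the origin is normal to \<open>l\<close> and has second coordinate -2; hence the line is not
  vertical, and its slope determines the rest.\<close>
lemma fold_origin_iff:
  assumes "is_line l"
  shows "reflection l (vector [0, 0]) $ 2 = -2 \<longleftrightarrow> (\<exists>s. l = fold_line s)"
proof
  assume "\<exists>s. l = fold_line s"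
  then obtain s where "l = fold_line s" by blast
  moreover have "s^2 + 1 \<noteq> 0" by (simp add: sum_power2_eq_zero_iff add_nonneg_eq_0_iff)
  ultimately show "reflection l (vector [0, 0]) $ 2 = -2" by (simp add: reflection_fold_line field_simps)
next
  assume r: "reflection l (vector [0, 0]) $ 2 = -2"
  obtain n c where n: "n \<noteq> 0" "l = {A. n \<bullet> A = c}" using assms by (auto simp: is_line_iff)
  have nn: "n \<bullet> n \<noteq> 0" using n(1) by simp
  have "c * n $ 2 = - (n \<bullet> n)"
    using r nn unfolding n(2) reflection_hyperplane[OF n(1)] by (simp add: inner_plane field_simps)
  then have cn: "c * n $ 2 = - (n $ 1 * n $ 1 + n $ 2 * n $ 2)" by (simp add: inner_plane)
  have n2: "n $ 2 \<noteq> 0" using cn nn by (auto simp: inner_plane)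
  define s where "s = - n $ 1 / n $ 2"
  have n1: "n $ 1 = - s * n $ 2" using n2 by (simp add: s_def)
  have c: "c = - (s^2 + 1) * n $ 2"
  proof -
    have "n $ 2 * c = n $ 2 * (- (s^2 + 1) * n $ 2)" using cn by (simp add: n1 power2_eq_square algebra_simps)
    then show ?thesis using n2 by simp
  qed
  have "l = fold_line s"
  proof (rule Set.set_eqI)
    fix A
    have "n \<bullet> A - c = n $ 2 * (A $ 2 - (s * A $ 1 - (s^2 + 1)))" by (simp add: inner_plane n1 c algebra_simps)
    then show "A \<in> l \<longleftrightarrow> A \<in> fold_line s" using n2 by (auto simp: n(2) fold_line_def)
  qed
  then show "\<exists>s. l = fold_line s" by blast
qed

text \<open>The point \<open>G\<close> as a function of the slope of the second line.\<close>
definition common_image :: "real \<Rightarrow> real^2" where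
  "common_image s = reflection (fold_line s) (vector [1, -1])"

text \<open>Measured from \<open>Q = (-3, -3)\<close>, these are the coordinates of the displacement of \<open>Q\<close> in the first fold.\<close>
lemma common_image_coordinates:
  "common_image s $ 1 + 3 = 2 * (s^3 + s^2 + 2) / (s^2 + 1)" "common_image s $ 2 + 3 = 2 * (s + 1) / (s^2 + 1)"
proof -
  have "s^2 + 1 \<noteq> 0" by (simp add: add_nonneg_eq_0_iff)
  then show "common_image s $ 1 + 3 = 2 * (s^3 + s^2 + 2) / (s^2 + 1)" "common_image s $ 2 + 3 = 2 * (s + 1) / (s^2 + 1)"
    by (simp_all add: common_image_def reflection_fold_line field_simps power2_eq_square power3_eq_cube)
qed

text \<open>On the left is the incidence of the image of \<open>P\<close> with \<open>m\<close>, multiplied by the squared length of the displacement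
  \<open>(x, y)\<close> of \<open>Q\<close>. That length contributes a factor \<open>w\<close> to the numerator, so \<open>w\<^sup>2\<close> instead of
  \<open>w\<^sup>3\<close> clears the denominators.\<close>
lemma septic_condition:
  fixes s :: real
  assumes w: "w = s^2 + 1" and x: "x * w = 2 * (s^3 + s^2 + 2)" and y: "y * w = 2 * (s + 1)"
  shows "w^2 * ((-1/5 + x / 2 - y) * (x * x + y * y) - 2 * (-x / 5 + 3 * y / 5) * (x / 2 - y)) = 4 * poly septic s"
proof -
  have w0: "w \<noteq> 0" unfolding w by (simp add: add_nonneg_eq_0_iff)
  have "w * (w^2 * ((-1/5 + x / 2 - y) * (x * x + y * y) - 2 * (-x / 5 + 3 * y / 5) * (x / 2 - y)))
      = (-w/5 + (x * w) / 2 - y * w) * ((x * w)^2 + (y * w)^2) - 2 * w * (-(x * w) / 5 + 3 * (y * w) / 5) * ((x * w) / 2 - y * w)"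
    by (simp add: field_simps power2_eq_square)
  also have "\<dots> = w * (4 * poly septic s)"
    unfolding x y unfolding w by (simp add: septic_def field_simps eval_nat_numeral)
  finally show ?thesis using w0 by simp
qed

lemma common_image_ne: "common_image s \<noteq> vector [-3, -3]"
proof
  assume "common_image s = vector [-3, -3]"
  moreover have "s^2 + 1 \<noteq> 0" by (simp add: add_nonneg_eq_0_iff)
  ultimately have "s^3 + s^2 + 2 = 0" "s + 1 = 0" using common_image_coordinates[of s] by simp_all
  then have "s = -1" by simp
  with \<open>s^3 + s^2 + 2 = 0\<close> show False by simp
qed

text \<open>Once the slope of the second line is fixed, the displacement of \<open>Q\<close> determines the first reflection, and what remains is
  one equation in \<open>s\<close>.\<close>
lemma second_fold_iff:
  assumes "is_line l" "reflection l (vector [-3, -3]) = common_image s"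
  shows "reflection l (vector [-16/5, -12/5]) \<in> {A. A $ 2 = 1/2 * A $ 1 - 1} \<longleftrightarrow> poly septic s = 0"
proof -
  obtain n c where n: "n \<noteq> 0" "l = {A. n \<bullet> A = c}" using assms(1) by (auto simp: is_line_iff)
  define D where "D = common_image s - vector [-3, -3]"
  have D: "D = reflection {A. n \<bullet> A = c} (vector [-3, -3]) - vector [-3, -3]" "D \<noteq> 0"
    using assms(2) n(2) common_image_ne by (simp_all add: D_def)
  define w where "w = s^2 + 1"
  have w0: "w \<noteq> 0" unfolding w_def by (simp add: add_nonneg_eq_0_iff)
  define x y where "x = D $ 1" and "y = D $ 2"
  have XY: "x * w = 2 * (s^3 + s^2 + 2)" "y * w = 2 * (s + 1)"
    using common_image_coordinates[of s] w0 by (simp_all add: x_def y_def D_def w_def)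
  have DD: "D \<bullet> D = x * x + y * y" by (simp add: inner_plane x_def y_def)
  then have DD0: "x * x + y * y \<noteq> 0" using D(2) by (metis inner_eq_zero_iff)
  define k where "k = 2 * (- x / 5 + 3 * y / 5) / (x * x + y * y)"
  have r: "reflection l (vector [-16/5, -12/5]) = vector [-16/5, -12/5] + D - k *\<^sub>R D"
    unfolding n(2) reflection_from_image[OF n(1) D] DD by (simp add: k_def inner_plane x_def y_def)
  have "reflection l (vector [-16/5, -12/5]) \<in> {A. A $ 2 = 1/2 * A $ 1 - 1}
     \<longleftrightarrow> (-1/5 + x / 2 - y) - k * (x / 2 - y) = 0"
    unfolding r by (auto simp: x_def y_def algebra_simps)
  also have "\<dots> \<longleftrightarrow> ((-1/5 + x / 2 - y) - k * (x / 2 - y)) * (x * x + y * y) = 0"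
    by (simp only: mult_eq_0_iff DD0 simp_thms)
  also have "((-1/5 + x / 2 - y) - k * (x / 2 - y)) * (x * x + y * y)
     = (-1/5 + x / 2 - y) * (x * x + y * y) - (k * (x * x + y * y)) * (x / 2 - y)" by (simp add: algebra_simps)
  also have "k * (x * x + y * y) = 2 * (- x / 5 + 3 * y / 5)" using DD0 by (simp add: k_def)
  also have "(-1/5 + x / 2 - y) * (x * x + y * y) - 2 * (- x / 5 + 3 * y / 5) * (x / 2 - y) = 0
     \<longleftrightarrow> w^2 * ((-1/5 + x / 2 - y) * (x * x + y * y) - 2 * (- x / 5 + 3 * y / 5) * (x / 2 - y)) = 0"
    using w0 by simp
  also have "\<dots> \<longleftrightarrow> poly septic s = 0"
    using septic_condition[OF w_def XY] by simp
  finally show ?thesis .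
qed

text \<open>The displacement from \<open>S\<close> is normal to the second line and vanishes only for \<open>s = 0\<close> and \<open>s = 1\<close>, which are not
  roots, so the slope can be recovered.\<close>
lemma common_image_inj_on: "inj_on common_image {s. poly septic s = 0}"
proof (rule inj_onI)
  fix s t assume st: "s \<in> {s. poly septic s = 0}" "t \<in> {s. poly septic s = 0}" "common_image s = common_image t"
  have slope: "s = - (common_image s $ 1 - 1) / (common_image s $ 2 + 1)" if "poly septic s = 0" for s
  proof -
    have "s \<noteq> 0" "s \<noteq> 1" using that by (auto simp: septic_def)
    then have "s - s^2 \<noteq> 0" by (simp add: power2_eq_square)
    moreover have "s^2 + 1 \<noteq> 0" by (simp add: add_nonneg_eq_0_iff)
    moreover have "common_image s $ 1 - 1 = - (2 * (s - s^2) / (s^2 + 1)) * s" "common_image s $ 2 + 1 = 2 * (s - s^2) / (s^2 + 1)"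
      using \<open>s^2 + 1 \<noteq> 0\<close>
      by (simp_all add: common_image_def reflection_fold_line field_simps power2_eq_square power3_eq_cube)
    ultimately show ?thesis by simp
  qed
  from slope[of s] slope[of t] st show "s = t" by simp
qed

section \<open>Counting the solutions\<close>

text \<open>The real roots are those fixed by complex conjugation, whose action on the indices is known.\<close>
lemma card_real_septic_roots: "card {s::real. poly septic s = 0} = 3"
proof -
  have real: "complex_of_real ` {s. poly septic s = 0} = septic_root ` {1, 2, 3}"
  proof (intro equalityI subsetI)
    fix z assume "z \<in> complex_of_real ` {s. poly septic s = 0}"
    then obtain s where s: "z = of_real s" "poly septic s = 0" by blast
    have "poly septic z = complex_of_real (poly septic s)" unfolding s(1) by (simp add: septic_def)
    then have "poly septic z = 0" using s(2) by simp
    then obtain i where i: "i \<in> {1..<8}" "z = septic_root i" using septic_zeros by blast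
    have "cnj z = z" using s(1) by simp
    then have "septic_root (conj_index i) = septic_root i" using cnj_septic_root[of i] i by simp
    moreover have "i = 1 \<or> i = 2 \<or> i = 3 \<or> i = 4 \<or> i = 5 \<or> i = 6 \<or> i = 7" using i(1) by auto
    moreover from this have "conj_index i < 8" by (auto simp: conj_index_def)
    ultimately have "i \<in> {1, 2, 3}"
      using inj_onD[OF inj_septic_root, of "conj_index i" i] by (auto simp: conj_index_def)
    then show "z \<in> septic_root ` {1, 2, 3}" using i(2) by blast
  next
    fix z assume "z \<in> septic_root ` {1, 2, 3}"
    then obtain i where i: "i \<in> {1, 2, 3}" "z = septic_root i" by blast
    then have "cnj z = z" using cnj_septic_root[of i] by (auto simp: conj_index_def)
    then have "z = complex_of_real (Re z)" by (metis complex_is_Real_iff Reals_cnj_iff of_real_Re)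
    moreover have "poly septic z = 0" using i poly_septic_root[of i] by auto
    moreover have "poly septic (complex_of_real s) = complex_of_real (poly septic s)" for s by (simp add: septic_def)
    ultimately have "poly septic (Re z) = 0" by (metis of_real_eq_0_iff)
    with \<open>z = complex_of_real (Re z)\<close> show "z \<in> complex_of_real ` {s. poly septic s = 0}" by blast
  qed
  have "card {s::real. poly septic s = 0} = card (complex_of_real ` {s. poly septic s = 0})"
    by (rule card_image[symmetric]) (simp add: inj_on_def)
  also have "\<dots> = card {1, 2, 3 :: nat}"
    unfolding real by (rule card_image) (rule inj_on_subset[OF inj_septic_root], auto)
  finally show ?thesis by simp
qed

lemma origami_solution_iff:
  assumes "is_line l1" "is_line l2"
  shows "reflection l1 (vector [-16/5, -12/5]) \<in> {A. A $ 2 = 1/2 * A $ 1 - 1} \<and> reflection l2 (vector [0, 0]) \<in> {A. A $ 2 = -2}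
     \<and> reflection l1 (vector [-3, -3]) = reflection l2 (vector [1, -1])
   \<longleftrightarrow> (\<exists>s. l2 = fold_line s \<and> reflection l1 (vector [-3, -3]) = common_image s \<and> poly septic s = 0)"
  using fold_origin_iff[OF assms(2)] second_fold_iff[OF assms(1)] by (auto simp: common_image_def)

lemma has_slope_fold_line: "has_slope (fold_line s) s"
  unfolding has_slope_def fold_line_def by (intro exI[of _ "- (s^2 + 1)"]) (simp only: diff_conv_add_uminus)

lemma common_images:
  "{G. \<exists>l1 l2. is_line l1 \<and> is_line l2 \<and> reflection l1 (vector [-16/5, -12/5]) \<in> {A. A $ 2 = 1/2 * A $ 1 - 1}
      \<and> reflection l2 (vector [0, 0]) \<in> {A. A $ 2 = -2}
      \<and> reflection l1 (vector [-3, -3]) = G \<and> G = reflection l2 (vector [1, -1])}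
   = common_image ` {s. poly septic s = 0}" (is "?S = _")
proof (intro equalityI subsetI)
  fix G assume "G \<in> ?S"
  then obtain l1 l2 where l: "is_line l1" "is_line l2" "reflection l1 (vector [-16/5, -12/5]) \<in> {A. A $ 2 = 1/2 * A $ 1 - 1}"
      "reflection l2 (vector [0, 0]) \<in> {A. A $ 2 = -2}" "reflection l1 (vector [-3, -3]) = G" "G = reflection l2 (vector [1, -1])"
    unfolding mem_Collect_eq by (elim exE conjE)
  from origami_solution_iff[OF l(1,2)] l(3-6) obtain s where "G = common_image s" "poly septic s = 0"
    by metis
  then show "G \<in> common_image ` {s. poly septic s = 0}" by simp
next
  fix G assume "G \<in> common_image ` {s. poly septic s = 0}"
  then obtain s where s: "poly septic s = 0" "G = common_image s" by blast
  have ne: "vector [-3, -3] \<noteq> common_image s" using common_image_ne[of s] by metis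
  let ?l = "bisector (vector [-3, -3]) (common_image s)"
  have l: "is_line ?l" by (rule is_line_bisector[OF ne])
  have r: "reflection ?l (vector [-3, -3]) = common_image s" by (rule reflection_bisector[OF ne])
  have folds: "reflection ?l (vector [-16/5, -12/5]) \<in> {A. A $ 2 = 1/2 * A $ 1 - 1} \<and> reflection (fold_line s) (vector [0, 0]) \<in> {A. A $ 2 = -2}
    \<and> reflection ?l (vector [-3, -3]) = reflection (fold_line s) (vector [1, -1])"
    unfolding origami_solution_iff[OF l is_line_fold_line] using r s(1) by blast
  show "G \<in> ?S"
    unfolding s(2)
    by (intro CollectI exI[of _ ?l] exI[of _ "fold_line s"] conjI l is_line_fold_line r common_image_def
        folds[THEN conjunct1] folds[THEN conjunct2, THEN conjunct1])
qed

theorem mainTheorem4: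
  fixes m n :: "(real^2) set" and P Q R S :: "real^2" and p :: "rat poly"
  assumes "m = {A. A $ 2 = 1/2 * A $ 1 - 1}"
    and "P = vector [-16/5, -12/5]"
    and "Q = vector [-3, -3]"
    and "n = {A. A $ 2 = -2}"
    and "R = vector [0, 0]"
    and "S = vector [1, -1]"
    and "p = [:-1, -10, 1, 5, -3, 0, 3, 1:]"
  shows "(\<forall>l1 l2. is_line l1 \<and> is_line l2 \<and> reflection l1 P \<in> m \<and> reflection l2 R \<in> n \<and>
            reflection l1 Q = reflection l2 S \<longrightarrow>
            (\<exists>s. has_slope l2 s \<and> poly (map_poly of_rat p) s = 0))
    \<and> galois_group_of_poly p \<cong> (PSL :: (bit^3^3) set monoid)
    \<and> card {G. \<exists>l1 l2. is_line l1 \<and> is_line l2 \<and> reflection l1 P \<in> m \<and> reflection l2 R \<in> n \<and>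
            reflection l1 Q = G \<and> G = reflection l2 S} = 3"
proof -
  have p: "p = septic" by (simp add: assms(7) septic_def)
  have real: "map_poly of_rat (septic :: rat poly) = (septic :: real poly)"
    by (simp add: septic_def map_poly_pCons)
  have "\<exists>s. has_slope l2 s \<and> poly (map_poly of_rat p) s = 0"
    if "is_line l1" "is_line l2" "reflection l1 P \<in> m" "reflection l2 R \<in> n" "reflection l1 Q = reflection l2 S" for l1 l2
    using origami_solution_iff[OF that(1,2)] that(3-5) has_slope_fold_line
    unfolding assms(1-6) p real by blast
  moreover have "card {G. \<exists>l1 l2. is_line l1 \<and> is_line l2 \<and> reflection l1 P \<in> m \<and> reflection l2 R \<in> n \<and>
            reflection l1 Q = G \<and> G = reflection l2 S} = 3"
    unfolding assms(1-6) common_images using card_image[OF common_image_inj_on] card_real_septic_roots by simp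
  ultimately show ?thesis using galois_group_septic unfolding p by blast
qed

end
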